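(* Fix an integer $n \geq 2$. The expected complexity of the Beneath-Beyond algorithm with input $P \sim P(n,m)$ (given by its vertices $a_1,\dots,a_m$) is $\tilde{O}(m^2)$ as $m \to \infty$; that is, there are constants $C$ and $k$ depending only on $n$ such that this expectation is at most $C\, m^2 (\log m)^k$ for all sufficiently large $m$.
   Context: $P(n,m)$ denotes the distribution of the convex hull $P$ of $m$ points $a_1,\dots,a_m$ chosen independently and uniformly at random from the unit sphere $S^{n-1} \subset \mathbb{R}^n$. The Beneath-Beyond algorithm computes the facets of a polytope from its vertices incrementally. Fix the order $a_1,\dots,a_m$ of the vertices and let $P_t$ be the convex hull of $0,a_1,\dots,a_t$. The algorithm starts from the simplex $P_n$. At step $t$ (for $n \leq t < m$) the list of facets of $P_t$, together with the $(n-2)$-dimensional faces of each facet, is known, and it is updated to the list for $P_{t+1}$ as follows. For each facet $F$ of $P_t$, check, by evaluating the corresponding linear inequality at $a_{t+1}$, whether $a_{t+1}$ lies on the same side of the hyperplane spanned by $F$ as $P_t$. If it does, $F$ is kept as a facet of $P_{t+1}$. Otherwise $F$ is removed, and each of the $n$ $(n-2)$-dimensional faces $R$ of $F$ is processed: the cone over $R$ with cone point $a_{t+1}$ is added as a new facet whenever it is a facet of $P_{t+1}$. (Almost surely all $P_t$ with $t\ge n$ are simplicial, so every facet has exactly $n$ faces of dimension $n-2$.) The complexity is the total number of elementary operations over all steps, where an elementary operation is the check of one facet inequality at $a_{t+1}$, the removal of one facet, or the processing of one $(n-2)$-dimensional face of a removed facet; since $n$ is fixed, each is counted as one unit of cost.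 *)

theory Defs
  imports "HOL-Probability.Probability"
begin

text \<open>
  The ambient space is \<open>real ^ 'n\<close>, so \<open>CARD('n)\<close> is the dimension \<open>n\<close>. A configuration
  \<open>a\<^sub>1, \<dots>, a\<^sub>m\<close> is a function on \<open>nat\<close> of which only the values on \<open>{1..m}\<close> matter.
\<close>

text \<open>
  The uniform distribution on the unit sphere: the radial projection of the uniform distribution
  on the unit ball (the normalised surface measure). The lemmas below confirm that it is a
  probability measure concentrated on the sphere and invariant under orthogonal transformations,
  which characterises it. (In the last one, \<open>wellorder\<close> comes from the library lemma on volumes of
  orthogonal images; every dimension has an index type of this class.)
\<close>

definition uniform_sphere :: "(real ^ 'n) measure" where
  "uniform_sphere = distr (uniform_measure lborel (ball 0 1)) borel sgn"

lemma sgn_borel_measurable [measurable]: "(sgn :: real ^ 'n \<Rightarrow> real ^ 'n) \<in> borel_measurable borel"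
  unfolding sgn_div_norm by measurable

lemma emeasure_unit_ball:
  "emeasure lborel (ball (0 :: real ^ 'n) 1) \<noteq> 0" "emeasure lborel (ball (0 :: real ^ 'n) 1) \<noteq> \<infinity>"
proof -
  have "measure lborel (ball (0 :: real ^ 'n) 1) > 0"
    using content_ball_pos[of 1 "0 :: real ^ 'n"] by simp
  then show "emeasure lborel (ball (0 :: real ^ 'n) 1) \<noteq> 0"
    by (auto simp: measure_def)
  show "emeasure lborel (ball (0 :: real ^ 'n) 1) \<noteq> \<infinity>"
    using emeasure_bounded_finite[of "ball (0 :: real ^ 'n) 1"] by auto
qed

lemma prob_space_uniform_sphere: "prob_space (uniform_sphere :: (real ^ 'n) measure)"
  unfolding uniform_sphere_def
  by (intro prob_space.prob_space_distr prob_space_uniform_measure emeasure_unit_ball) measurable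

lemma AE_uniform_sphere: "AE x in (uniform_sphere :: (real ^ 'n) measure). x \<in> sphere 0 1"
proof -
  have "AE x in lborel. x \<noteq> (0 :: real ^ 'n)"
    by (rule AE_lborel_singleton)
  then have "AE x in uniform_measure lborel (ball 0 1). x \<noteq> (0 :: real ^ 'n)"
    by (intro AE_uniform_measureI) auto
  then show ?thesis
    unfolding uniform_sphere_def by (subst AE_distr_iff) (auto simp: norm_sgn)
qed

lemma uniform_sphere_orthogonal_invariant:
  fixes f :: "real ^ 'n :: {finite, wellorder} \<Rightarrow> real ^ 'n :: _"
  assumes f: "orthogonal_transformation f"
  shows "distr uniform_sphere borel f = uniform_sphere"
proof (rule measure_eqI)
  show "sets (distr uniform_sphere borel f) = sets uniform_sphere"
    by (simp add: uniform_sphere_def)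
next
  fix A :: "(real ^ 'n :: _) set"
  assume "A \<in> sets (distr uniform_sphere borel f)"
  then have A: "A \<in> sets borel" by simp
  have [measurable]: "f \<in> borel_measurable borel"
    using f by (intro borel_measurable_continuous_onI linear_continuous_on)
      (simp add: orthogonal_transformation_def linear_linear)
  define S T where "S = ball 0 1 \<inter> sgn -` f -` A" and "T = ball 0 1 \<inter> sgn -` A"
  have S: "S \<in> sets borel" and T: "T \<in> sets borel"
    using A unfolding S_def T_def
    by (auto intro!: sets.Int measurable_sets_borel[OF sgn_borel_measurable]
        measurable_sets_borel[of f])
  have lin: "linear f" and nrm: "\<And>x. norm (f x) = norm x" and bj: "bij f"
    using f by (auto simp: orthogonal_transformation orthogonal_transformation_bij)
  have sgnf: "sgn (f x) = f (sgn x)" for x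
    by (simp add: sgn_div_norm nrm linear_scale[OF lin])
  have "T = f ` S"
  proof
    show "f ` S \<subseteq> T" by (auto simp: S_def T_def nrm sgnf)
    show "T \<subseteq> f ` S"
    proof
      fix y assume y: "y \<in> T"
      obtain x where "y = f x" using bj by (metis bij_pointE)
      with y show "y \<in> f ` S" by (auto simp: S_def T_def nrm sgnf)
    qed
  qed
  have lm: "S \<in> lmeasurable" "T \<in> lmeasurable"
    using S T by (auto intro!: bounded_set_imp_lmeasurable simp: S_def T_def)
  have "measure lebesgue T = measure lebesgue S"
    unfolding \<open>T = f ` S\<close> using measure_orthogonal_image[OF f lm(1)] .
  then have "measure lborel T = measure lborel S"
    using S T by (simp add: measure_completion)
  moreover have "emeasure lborel S \<noteq> \<top>" "emeasure lborel T \<noteq> \<top>"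
    using emeasure_bounded_finite[of S] emeasure_bounded_finite[of T]
    by (auto simp: S_def T_def bounded_Int)
  ultimately have eq: "emeasure lborel T = emeasure lborel S"
    by (metis emeasure_eq_ennreal_measure)
  have fA: "f -` A \<in> sets borel" "sgn -` A \<in> sets borel" "sgn -` f -` A \<in> sets borel"
    using A by (auto intro!: measurable_sets_borel[OF sgn_borel_measurable]
        measurable_sets_borel[of f])
  have m: "f \<in> measurable uniform_sphere borel"
    "sgn \<in> measurable (uniform_measure lborel (ball 0 1)) (borel :: (real ^ 'n :: _) measure)"
    unfolding uniform_sphere_def by measurable
  have "emeasure (distr uniform_sphere borel f) A = emeasure uniform_sphere (f -` A)"
    using A m(1) by (simp add: emeasure_distr uniform_sphere_def)
  also have "\<dots> = emeasure (uniform_measure lborel (ball 0 1)) (sgn -` f -` A)"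
    using fA m(2) by (simp add: emeasure_distr uniform_sphere_def)
  also have "\<dots> = emeasure (uniform_measure lborel (ball 0 1)) (sgn -` A)"
    using fA eq by (simp add: S_def T_def)
  also have "\<dots> = emeasure uniform_sphere A"
    using A m(2) by (simp add: emeasure_distr uniform_sphere_def)
  finally show "emeasure (distr uniform_sphere borel f) A = emeasure uniform_sphere A" .
qed

text \<open>
  The law of \<open>m\<close> independent uniform points. The product measure is completed because the
  algorithm only has its intended behaviour almost surely (for inputs in general position), so
  that its cost needs to be measurable only up to null sets.
\<close>

definition sphere_sample :: "nat \<Rightarrow> (nat \<Rightarrow> real ^ 'n) measure" where
  "sphere_sample m = completion (\<Pi>\<^sub>M i\<in>{1..m}. uniform_sphere)"

definition bb_polytope :: "(nat \<Rightarrow> real ^ 'n) \<Rightarrow> nat \<Rightarrow> (real ^ 'n) set" where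
  "bb_polytope a t = convex hull (insert 0 (a ` {1..t}))"

text \<open>
  For a facet \<open>F\<close> of a full-dimensional \<open>P\<close>, the pair \<open>(u, c)\<close> is unique up to positive scaling. A point
  on the hyperplane itself (a null event) counts as being on the same side.
\<close>

definition same_side :: "(real ^ 'n) set \<Rightarrow> (real ^ 'n) set \<Rightarrow> real ^ 'n \<Rightarrow> bool" where
  "same_side P F x \<longleftrightarrow>
     (\<exists>u c. u \<noteq> 0 \<and> affine hull F = {y. u \<bullet> y = c} \<and> P \<subseteq> {y. u \<bullet> y \<le> c} \<and> u \<bullet> x \<le> c)"

definition ridges :: "(real ^ 'n) set \<Rightarrow> (real ^ 'n) set set" where
  "ridges F = {R. R face_of F \<and> aff_dim R = int CARD('n) - 2}"

definition bb_removed ::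
  "(nat \<Rightarrow> real ^ 'n) \<Rightarrow> nat \<Rightarrow> (real ^ 'n) set set \<Rightarrow> (real ^ 'n) set set" where
  "bb_removed a t Fs = {F \<in> Fs. \<not> same_side (bb_polytope a t) F (a (Suc t))}"

definition bb_new ::
  "(nat \<Rightarrow> real ^ 'n) \<Rightarrow> nat \<Rightarrow> (real ^ 'n) set set \<Rightarrow> (real ^ 'n) set set" where
  "bb_new a t Fs =
     {G. \<exists>F \<in> bb_removed a t Fs. \<exists>R \<in> ridges F.
           G = convex hull (insert (a (Suc t)) R) \<and> G facet_of bb_polytope a (Suc t)}"

text \<open>
  \<open>bb_facets a k\<close> is the list of facets maintained by the algorithm after \<open>k\<close> steps, that is, at
  the time \<open>t = n + k\<close>.
\<close>

primrec bb_facets :: "(nat \<Rightarrow> real ^ 'n) \<Rightarrow> nat \<Rightarrow> (real ^ 'n) set set" where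
  "bb_facets a 0 = {F. F facet_of bb_polytope a CARD('n)}"
| "bb_facets a (Suc k) =
     (bb_facets a k - bb_removed a (CARD('n) + k) (bb_facets a k))
       \<union> bb_new a (CARD('n) + k) (bb_facets a k)"

text \<open>
  One unit for each facet checked, one for each facet removed, and one for each
  \<open>(n - 2)\<close>-dimensional face of each removed facet.
\<close>

definition bb_step_cost :: "(nat \<Rightarrow> real ^ 'n) \<Rightarrow> nat \<Rightarrow> (real ^ 'n) set set \<Rightarrow> nat" where
  "bb_step_cost a t Fs =
     card Fs + card (bb_removed a t Fs) + (\<Sum>F\<in>bb_removed a t Fs. card (ridges F))"

definition bb_complexity :: "nat \<Rightarrow> (nat \<Rightarrow> real ^ 'n) \<Rightarrow> nat" where
  "bb_complexity m a =
     (\<Sum>k < m - CARD('n). bb_step_cost a (CARD('n) + k) (bb_facets a k))"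

end

theory Submission
  imports Defs
begin

text \<open>
  Each step costs at most \<open>n + 2\<close> times the number of facets of \<open>P\<^sub>t\<close>, so it suffices that \<open>P\<^sub>t\<close> has
  \<open>O(t (log m)\<^bsup>n-1\<^esup>)\<close> facets in expectation. A facet with vertices \<open>a\<^sub>i\<close>, \<open>i \<in> I\<close>, cuts off an empty
  cap. A cap of radius \<open>s\<close> has measure of order \<open>s\<^bsup>n-1\<^esup>\<close>. If this is at least of order \<open>log m / t\<close>, the
  cap is empty with probability at most \<open>m\<^bsup>-n\<^esup>\<close>; otherwise the \<open>n\<close> points lie within distance \<open>2 s\<close> of
  each other, which has probability \<open>O((log m / t)\<^bsup>n-1\<^esup>)\<close>. There are at most \<open>t\<^bsup>n\<^esup>\<close> index sets \<open>I\<close>. For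
  facets through the origin the caps are hemispheres, so these are negligible.
\<close>

subsection \<open>Caps and hyperplane sections of the sphere\<close>

text \<open>Fixing one deterministic radius \<open>s\<close> replaces an integration over the height
  of the hyperplane spanned by \<open>I\<close>; the price is the power of the logarithm. The number
  of index sets times the probability of close points leaves a single factor \<open>t\<close>, and
  summing over \<open>t < m\<close> gives the square.

  Adding the origin to the hull means that the halfspace containing the polytope contains the centre
  of the sphere. So the empty cap never exceeds a hemisphere, and its boundary radius controls both
  its measure and the spread of the points on the boundary.

  The obstacle is measurability, since the algorithm manipulates sets of polytopes. In general
  position a facet is determined by its index set and each test by signs of determinants, so the
  cost agrees almost surely with a function of finitely many measurable predicates.\<close>

lemma sets_uniform_sphere [simp, measurable_cong]:
  "sets (uniform_sphere :: (real ^ 'n) measure) = sets borel"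
  by (simp add: uniform_sphere_def)

lemma space_uniform_sphere [simp]: "space (uniform_sphere :: (real ^ 'n) measure) = UNIV"
  by (simp add: uniform_sphere_def)

lemma ball_Int_sgn_vimage_borel [measurable]:
  fixes A :: "(real ^ 'n) set"
  shows "A \<in> sets borel \<Longrightarrow> ball 0 1 \<inter> sgn -` A \<in> sets borel"
  by (auto intro!: sets.Int measurable_sets_borel[OF sgn_borel_measurable])

lemma fmeasurable_ball_Int:
  fixes A :: "(real ^ 'n) set"
  shows "A \<in> sets borel \<Longrightarrow> ball c r \<inter> A \<in> fmeasurable lborel"
  using emeasure_bounded_finite[of "ball c r \<inter> A"]
  by (auto simp: fmeasurable_def bounded_Int)

text \<open>The cone over \<open>A\<close> inside the unit ball is the preimage of \<open>A\<close>
  under radial projection, so estimates on the sphere become volume comparisons with families of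
  balls.\<close>

lemma measure_uniform_sphere:
  fixes A :: "(real ^ 'n) set"
  assumes A: "A \<in> sets borel"
  shows "measure uniform_sphere A =
    measure lborel (ball 0 1 \<inter> sgn -` A) / unit_ball_vol (real CARD('n))"
proof -
  have "measure uniform_sphere A = measure (uniform_measure lborel (ball 0 1)) (sgn -` A)"
    unfolding uniform_sphere_def using A by (subst measure_distr) (auto intro: sgn_borel_measurable)
  also have "\<dots> = measure lborel (ball 0 1 \<inter> sgn -` A) / measure lborel (ball (0 :: real ^ 'n) 1)"
    using A emeasure_unit_ball[where 'n = 'n] measurable_sets_borel[OF sgn_borel_measurable A]
    by (intro measure_uniform_measure) auto
  finally show ?thesis by (simp add: content_ball)
qed

text \<open>The cone over the cap is a thin tube around the segment from 0 to \<open>y\<close>: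
  about \<open>1 / r\<close> balls of radius \<open>2 * r\<close> cover it, each of volume
  proportional to \<open>r ^ n\<close>, which leaves \<open>r ^ (n - 1)\<close>.\<close>

lemma measure_uniform_sphere_cball_le:
  fixes y :: "real ^ 'n"
  assumes y: "norm y = 1" and r: "r > 0"
  shows "measure uniform_sphere (cball y r) \<le> 2 ^ (CARD('n) + 1) * r ^ (CARD('n) - 1)"
proof (cases "r \<le> 1")
  case False
  interpret prob_space "uniform_sphere :: (real ^ 'n) measure" by (rule prob_space_uniform_sphere)
  have "1 * 1 \<le> (2::real) ^ (CARD('n) + 1) * r ^ (CARD('n) - 1)"
    using False by (intro mult_mono one_le_power) auto
  then show ?thesis using prob_le_1[of "cball y r"] by linarith
next
  case True
  let ?n = "CARD('n)" and ?w = "unit_ball_vol (real CARD('n))"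
  define K where "K = nat \<lfloor>1 / r\<rfloor>"
  define B where "B k = ball ((real k * r) *\<^sub>R y) (2 * r)" for k
  \<comment> \<open>The radius \<open>2 * r\<close> allows \<open>r\<close> for rounding
    \<open>norm x\<close> down to a multiple of \<open>r\<close>, and less than \<open>r\<close> for
    the deviation of \<open>x\<close> from \<open>norm x *\<^sub>R y\<close>.\<close>
  have sub: "ball 0 1 \<inter> sgn -` cball y r \<subseteq> (\<Union>k\<le>K. B k)"
  proof
    fix x assume "x \<in> ball 0 1 \<inter> sgn -` cball y r"
    then have x: "norm x < 1" "norm (y - sgn x) \<le> r" by (auto simp: dist_norm)
    define k where "k = nat \<lfloor>norm x / r\<rfloor>"
    have "norm x / r \<le> 1 / r" using x r by (simp add: divide_right_mono)
    then have "k \<le> K" unfolding k_def K_def by (intro nat_mono floor_mono)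
    have "real k \<le> norm x / r" "norm x / r < real k + 1"
      using r by (auto simp: k_def)
    then have k: "real k * r \<le> norm x" "norm x < real k * r + r"
      using r by (auto simp: field_simps)
    have "norm ((real k * r) *\<^sub>R y - norm x *\<^sub>R y) = \<bar>real k * r - norm x\<bar>"
      using y by (simp flip: scaleR_diff_left)
    then have 1: "norm ((real k * r) *\<^sub>R y - norm x *\<^sub>R y) \<le> r" using k by linarith
    have "norm x *\<^sub>R y - x = norm x *\<^sub>R (y - sgn x)"
      by (cases "x = 0") (simp_all add: sgn_div_norm algebra_simps)
    then have "norm (norm x *\<^sub>R y - x) = norm x * norm (y - sgn x)" by simp
    also have "\<dots> < r"
    proof (cases "norm x = 0")
      case False
      then have "norm x * norm (y - sgn x) \<le> norm x * r" using x by (simp add: mult_left_mono)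
      also have "\<dots> < r" using x r by simp
      finally show ?thesis .
    qed (use r in simp)
    finally have "norm ((real k * r) *\<^sub>R y - x) < 2 * r"
      using 1 norm_triangle_ineq[of "(real k * r) *\<^sub>R y - norm x *\<^sub>R y" "norm x *\<^sub>R y - x"] by simp
    with \<open>k \<le> K\<close> show "x \<in> (\<Union>k\<le>K. B k)" by (auto simp: B_def dist_norm)
  qed
  have fm: "B k \<in> fmeasurable lborel" for k
    unfolding B_def using fmeasurable_ball_Int[of UNIV] by simp
  have cB: "measure lborel (B k) = ?w * (2 * r) ^ ?n" for k
    unfolding B_def using r by (simp add: content_ball)
  have "measure lborel (ball 0 1 \<inter> sgn -` cball y r) \<le> measure lborel (\<Union>k\<le>K. B k)"
    using sub fm by (intro measure_mono_fmeasurable fmeasurable.finite_UN) auto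
  also have "\<dots> \<le> (\<Sum>k\<le>K. measure lborel (B k))"
    using fm by (intro measure_subadditive_finite) (auto simp: fmeasurable_def less_top[symmetric])
  also have "\<dots> = (real K + 1) * (?w * (2 * r) ^ ?n)" by (simp add: cB)
  also have "\<dots> \<le> (2 / r) * (?w * (2 * r) ^ ?n)"
  proof (intro mult_right_mono)
    have "real K \<le> 1 / r" using r by (simp add: K_def)
    then show "real K + 1 \<le> 2 / r" using True r by (auto simp: field_simps)
  qed (use r in auto)
  also have "\<dots> = ?w * (2 ^ (?n + 1) * r ^ (?n - 1))"
    using r by (cases ?n) (auto simp: power_mult_distrib)
  finally show ?thesis
    by (subst measure_uniform_sphere) (auto simp: field_simps)
qed

text \<open>Packing instead of covering: \<open>s\<close> is the radius of the sphere bounding the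
  cap, and at heights between 1/2 and 3/4 the cone over the cap has room for disjoint balls of
  radius \<open>s / 4\<close> centred on its axis at spacing \<open>s / 2\<close>. Their number
  exceeds \<open>1 / (2 * s)\<close>.\<close>

lemma measure_uniform_sphere_cap_ge:
  fixes u :: "real ^ 'n"
  assumes u: "norm u = 1" and c: "0 \<le> c" "c < 1"
  defines "s \<equiv> sqrt (1 - c\<^sup>2)"
  shows "measure uniform_sphere {y. u \<bullet> y > c} \<ge> s ^ (CARD('n) - 1) / (2 * 4 ^ CARD('n))"
proof -
  let ?n = "CARD('n)" and ?w = "unit_ball_vol (real CARD('n))"
  have c2: "c\<^sup>2 < 1" using c by (simp add: power_less_one_iff abs_square_less_1)
  then have s: "0 < s" "s \<le> 1" "s\<^sup>2 = 1 - c\<^sup>2" unfolding s_def by auto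
  define K where "K = nat \<lfloor>1 / (2 * s)\<rfloor>"
  define l where "l k = 1 / 2 + real k * s / 2" for k
  define B where "B k = ball (l k *\<^sub>R u) (s / 4)" for k
  have K: "real K \<le> 1 / (2 * s)" "1 / (2 * s) < real K + 1" using s by (auto simp: K_def)
  have l: "1 / 2 \<le> l k" "k \<le> K \<Longrightarrow> l k \<le> 3 / 4" for k
  proof -
    show "1 / 2 \<le> l k" using s by (simp add: l_def)
    assume "k \<le> K"
    then have "real k \<le> 1 / (2 * s)" using K by linarith
    then have "real k * s \<le> 1 / (2 * s) * s" by (rule mult_right_mono) (use s in auto)
    also have "\<dots> = 1 / 2" using s by simp
    finally have "real k * s \<le> 1 / 2" .
    then show "l k \<le> 3 / 4" unfolding l_def by linarith
  qed
  have sub: "(\<Union>k\<le>K. B k) \<subseteq> ball 0 1 \<inter> sgn -` {y. u \<bullet> y > c}"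
  proof clarify
    fix k x assume k: "k \<le> K" and "x \<in> B k"
    define w where "w = x - l k *\<^sub>R u"
    have x: "x = l k *\<^sub>R u + w" by (simp add: w_def)
    have w: "norm w < s / 4" using \<open>x \<in> B k\<close> by (simp add: B_def w_def dist_norm norm_minus_commute)
    define \<alpha> where "\<alpha> = u \<bullet> w"
    have uu: "u \<bullet> u = 1" using u by (simp add: dot_square_norm)
    have ux: "u \<bullet> x = l k + \<alpha>" by (simp add: x inner_add_right uu \<alpha>_def)
    have "\<bar>\<alpha>\<bar> \<le> norm w" unfolding \<alpha>_def using Cauchy_Schwarz_ineq2[of u w] u by simp
    then have \<alpha>: "\<bar>\<alpha>\<bar> < s / 4" using w by simp
    have pos: "l k + \<alpha> \<ge> 1 / 4" using \<alpha> s l(1)[of k] by linarith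
    have nx: "(norm x)\<^sup>2 = (l k + \<alpha>)\<^sup>2 + ((norm w)\<^sup>2 - \<alpha>\<^sup>2)"
      unfolding power2_norm_eq_inner x
      by (simp add: inner_add_left inner_add_right uu inner_commute[of w u] flip: \<alpha>_def)
        (simp add: power2_eq_square algebra_simps)
    have "(norm w)\<^sup>2 < (s / 4)\<^sup>2" using w by (intro power_strict_mono) auto
    \<comment> \<open>Being in the cone means \<open>c * norm x < u \<bullet> x\<close>. Squared,
      with \<open>p\<close> the square of the axial component and \<open>q\<close> that of the
      orthogonal one, this reads \<open>c\<^sup>2 * q < (1 - c\<^sup>2) * p\<close>; here
      \<open>q\<close> is below \<open>(s / 4)\<^sup>2\<close> and \<open>p\<close> is at least
      \<open>(1 / 4)\<^sup>2\<close>.\<close>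
    have "c\<^sup>2 * ((norm w)\<^sup>2 - \<alpha>\<^sup>2) \<le> c\<^sup>2 * (norm w)\<^sup>2" by (intro mult_left_mono) auto
    also have "\<dots> \<le> 1 * (norm w)\<^sup>2" using c2 by (intro mult_right_mono) auto
    also have "\<dots> < (s / 4)\<^sup>2" using \<open>(norm w)\<^sup>2 < (s / 4)\<^sup>2\<close> by simp
    also have "\<dots> = s\<^sup>2 * (1 / 4)\<^sup>2" by (simp add: power_divide)
    also have "\<dots> \<le> s\<^sup>2 * (l k + \<alpha>)\<^sup>2" using pos by (intro mult_left_mono power_mono) auto
    finally have "c\<^sup>2 * ((norm w)\<^sup>2 - \<alpha>\<^sup>2) < (1 - c\<^sup>2) * (l k + \<alpha>)\<^sup>2" using s by simp
    moreover have "c\<^sup>2 * (p + q) < p" if "c\<^sup>2 * q < (1 - c\<^sup>2) * p" for p q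
      using that by (simp add: algebra_simps)
    ultimately have "(c * norm x)\<^sup>2 < (u \<bullet> x)\<^sup>2"
      unfolding power_mult_distrib nx ux by blast
    moreover have "0 \<le> u \<bullet> x" using pos ux by linarith
    ultimately have "c * norm x < u \<bullet> x" by (rule power2_less_imp_less)
    moreover have "u \<bullet> x \<noteq> 0" using pos ux by linarith
    then have "norm x \<noteq> 0" by (metis inner_zero_right norm_eq_zero)
    ultimately have "c < u \<bullet> sgn x" by (simp add: sgn_div_norm field_simps)
    moreover have "norm x < 1"
      using norm_triangle_ineq[of "l k *\<^sub>R u" w] w l[of k] k s by (simp add: x u)
    ultimately show "x \<in> ball 0 1 \<inter> sgn -` {y. u \<bullet> y > c}" by simp
  qed
  have disj: "disjoint_family_on B {..K}"
  proof (clarsimp simp: disjoint_family_on_def)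
    fix i j :: nat assume "i \<noteq> j"
    show "B i \<inter> B j = {}"
    proof (rule ccontr)
      assume "B i \<inter> B j \<noteq> {}"
      then obtain x where "x \<in> B i" "x \<in> B j" by auto
      then have "dist (l i *\<^sub>R u) (l j *\<^sub>R u) < s / 2"
        unfolding B_def mem_ball using dist_triangle_half_l[of "l i *\<^sub>R u" x "s/2" "l j *\<^sub>R u"]
        by (simp add: dist_commute)
      moreover have "dist (l i *\<^sub>R u) (l j *\<^sub>R u) = \<bar>real i - real j\<bar> * (s / 2)"
        using s u by (simp add: dist_norm l_def abs_mult flip: scaleR_diff_left left_diff_distrib diff_divide_distrib)
      moreover have "1 \<le> \<bar>real i - real j\<bar>" using \<open>i \<noteq> j\<close> by linarith
      then have "1 * (s / 2) \<le> \<bar>real i - real j\<bar> * (s / 2)" using s by (intro mult_right_mono) auto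
      ultimately show False by linarith
    qed
  qed
  have fm: "B k \<in> fmeasurable lborel" for k
    unfolding B_def using fmeasurable_ball_Int[of UNIV] by simp
  have cB: "measure lborel (B k) = ?w * (s / 4) ^ ?n" for k
    unfolding B_def using s by (simp add: content_ball)
  have "?w * (s ^ (?n - 1) / (2 * 4 ^ ?n)) = 1 / (2 * s) * (?w * (s / 4) ^ ?n)"
    using s by (cases ?n) (auto simp: power_divide field_simps)
  also have "\<dots> \<le> (real K + 1) * (?w * (s / 4) ^ ?n)"
    using K s by (intro mult_right_mono) auto
  also have "\<dots> = (\<Sum>k\<le>K. measure lborel (B k))" by (simp add: cB)
  also have "\<dots> = measure lborel (\<Union>k\<le>K. B k)"
    using fm disj by (intro measure_finite_Union[symmetric]) (auto simp: fmeasurable_def less_top[symmetric])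
  also have "\<dots> \<le> measure lborel (ball 0 1 \<inter> sgn -` {y. u \<bullet> y > c})"
  proof (intro measure_mono_fmeasurable sub)
    show "(\<Union>k\<le>K. B k) \<in> sets lborel" by (auto simp: B_def)
  qed (intro fmeasurable_ball_Int measurable_sets_borel[OF sgn_borel_measurable], simp)
  finally show ?thesis
    by (subst measure_uniform_sphere) (auto simp: field_simps)
qed

text \<open>The cone over the section, \<open>{x. u \<bullet> x = - w * norm x}\<close>, is Lebesgue
  null: either it lies in the frontier of a convex cone, or equality in Cauchy-Schwarz confines it
  to the line spanned by \<open>u\<close>, a null set in dimension at least 2.\<close>

lemma AE_uniform_sphere_notin_hyperplane:
  fixes u :: "real ^ 'n"
  assumes n: "CARD('n) \<ge> 2" and nz: "u \<noteq> 0 \<or> w \<noteq> 0"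
  shows "AE y in uniform_sphere. u \<bullet> y + w \<noteq> 0"
proof (cases "u = 0")
  case True
  with nz show ?thesis by simp
next
  case False
  \<comment> \<open>For \<open>w \<le> 0\<close> the function \<open>- w * norm x\<close> is convex,
    which makes \<open>S\<close> convex; the other sign is reached by negating \<open>u\<close> and
    \<open>w\<close>.\<close>
  have *: "AE y in uniform_sphere. u \<bullet> y + w \<noteq> 0" if "u \<noteq> 0" "w \<le> 0" for u :: "real ^ 'n" and w
  proof -
    define S where "S = {x. - w * norm x \<le> u \<bullet> x}"
    define Z where "Z = {x. u \<bullet> x = - w * norm x}"
    have "convex S"
    proof (rule convexI)
      fix x y and p q :: real
      assume *: "x \<in> S" "y \<in> S" "0 \<le> p" "0 \<le> q"
      have "- w * norm (p *\<^sub>R x + q *\<^sub>R y) \<le> - w * (p * norm x + q * norm y)"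
        using norm_triangle_ineq[of "p *\<^sub>R x" "q *\<^sub>R y"] * \<open>w \<le> 0\<close> by (intro mult_left_mono) auto
      also have "\<dots> = p * (- w * norm x) + q * (- w * norm y)" by (simp add: algebra_simps)
      also have "\<dots> \<le> p * (u \<bullet> x) + q * (u \<bullet> y)"
        using * by (intro add_mono mult_left_mono) (auto simp: S_def)
      finally show "p *\<^sub>R x + q *\<^sub>R y \<in> S" by (simp add: S_def inner_add_right)
    qed
    have "negligible Z"
    proof (cases "- w < norm u")
      case True
      have "Z \<subseteq> frontier S"
      proof
        fix x assume x: "x \<in> Z"
        have "x \<notin> interior S"
        proof
          assume "x \<in> interior S"
          then obtain e where e: "e > 0" "ball x e \<subseteq> S" by (meson mem_interior)
          define d where "d = e / (2 * norm u)"
          have d: "d > 0" "d * norm u < e" using e \<open>u \<noteq> 0\<close> by (auto simp: d_def)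
          have "x - d *\<^sub>R u \<in> ball x e" using d by (simp add: dist_norm)
          then have "x - d *\<^sub>R u \<in> S" using e by blast
          then have "- w * norm (x - d *\<^sub>R u) \<le> u \<bullet> (x - d *\<^sub>R u)" by (simp add: S_def)
          moreover have "norm x \<le> norm (x - d *\<^sub>R u) + d * norm u"
            using norm_triangle_ineq[of "x - d *\<^sub>R u" "d *\<^sub>R u"] d by simp
          then have "- w * norm x \<le> - w * (norm (x - d *\<^sub>R u) + d * norm u)"
            using \<open>w \<le> 0\<close> by (intro mult_left_mono) auto
          moreover have "d * norm u * (- w) < d * norm u * norm u"
            using True d \<open>u \<noteq> 0\<close> by (intro mult_strict_left_mono) auto
          ultimately show False
            using x by (simp add: Z_def inner_diff_right dot_square_norm power2_eq_square algebra_simps)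
        qed
        moreover have "x \<in> S" using x by (simp add: S_def Z_def)
        ultimately show "x \<in> frontier S" using closure_subset by (auto simp: frontier_def)
      qed
      then show ?thesis using negligible_convex_frontier[OF \<open>convex S\<close>] negligible_subset by blast
    next
      case False
      have "Z \<subseteq> span {u}"
      proof
        fix x assume "x \<in> Z"
        then have "norm u * norm x \<le> u \<bullet> x"
          using mult_right_mono[of "norm u" "- w" "norm x"] False by (simp add: Z_def)
        then have "u \<bullet> x = norm u * norm x" using norm_cauchy_schwarz[of u x] by linarith
        then have "norm u *\<^sub>R x = norm x *\<^sub>R u" by (simp add: norm_cauchy_schwarz_eq)
        then have "x = (norm x / norm u) *\<^sub>R u" using \<open>u \<noteq> 0\<close>
          by (metis divide_inverse_commute norm_eq_zero scaleR_scaleR scaleR_one left_inverse)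
        then show "x \<in> span {u}" by (metis span_base span_scale insertI1)
      qed
      then have "dim Z \<le> card {u}" by (rule dim_le_card) simp
      then show ?thesis using n by (intro negligible_lowdim) auto
    qed
    moreover have "Z \<in> sets borel" unfolding Z_def by measurable
    ultimately have "AE x in lborel. x \<notin> Z"
      by (metis AE_completion_iff AE_not_in negligible_iff_null_sets)
    then have "AE x in uniform_measure lborel (ball 0 1). u \<bullet> sgn x + w \<noteq> 0"
    proof (intro AE_uniform_measureI)
      show "AE x in lborel. x \<in> ball 0 1 \<longrightarrow> u \<bullet> sgn x + w \<noteq> 0"
        using \<open>AE x in lborel. x \<notin> Z\<close> AE_lborel_singleton[of 0]
      proof eventually_elim
        case (elim x)
        then show ?case by (auto simp: Z_def sgn_div_norm field_simps)
      qed
    qed simp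
    then show ?thesis
      unfolding uniform_sphere_def by (subst AE_distr_iff) auto
  qed
  show ?thesis
    using *[of u w] *[of "-u" "-w"] False by (cases "w \<le> 0") (auto elim!: eventually_mono)
qed

subsection \<open>General position\<close>

text \<open>The origin, which the algorithm adds to the points, gets the otherwise unused index \<open>0\<close>.\<close>

definition pt :: "(nat \<Rightarrow> real ^ 'n) \<Rightarrow> nat \<Rightarrow> real ^ 'n" where
  "pt a i = (if i = 0 then 0 else a i)"

section \<open>Affine independence as a nonvanishing determinant\<close>

definition lift_affine :: "real ^ 'n \<Rightarrow> real ^ 'n option" where
  "lift_affine x = (\<chi> k. case k of None \<Rightarrow> 1 | Some j \<Rightarrow> x $ j)"

text \<open>Up to sign, the volume of the simplex with vertices \<open>q i\<close> times the
  factorial of n. The index type \<open>'n option\<close> supplies both the \<open>n + 1\<close>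
  vertices and the extra homogeneous coordinate.\<close>

definition simplex_det :: "('n option \<Rightarrow> real ^ 'n) \<Rightarrow> real" where
  "simplex_det q = det (\<chi> i. lift_affine (q i))"

lemma sum_option: "(\<Sum>k\<in>UNIV. f k) = f None + (\<Sum>k\<in>(UNIV :: 'n :: finite set). f (Some k))"
  by (simp add: UNIV_option_conv sum.reindex)

text \<open>The determinant is linear in row \<open>i\<close>, hence an inner product with
  \<open>adjoint g 1\<close> in the lifted space; the coordinate belonging to \<open>None\<close>
  gives the constant term \<open>w\<close>.\<close>

lemma simplex_det_affine:
  fixes q :: "'n option \<Rightarrow> real ^ 'n"
  shows "\<exists>u w. \<forall>y. simplex_det (q(i := y)) = u \<bullet> y + w"
proof -
  define g :: "real ^ 'n option \<Rightarrow> real"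
    where "g v = det (\<chi> k. if k = i then v else lift_affine (q k))" for v
  have "linear g"
  proof (rule linearI)
    fix v v' :: "real ^ 'n option" and c :: real
    show "g (v + v') = g v + g v'" unfolding g_def by (rule det_row_add)
    show "g (c *\<^sub>R v) = c *\<^sub>R g v"
      using det_row_mul[where k = i and c = c and a = "\<lambda>_. v" and b = "\<lambda>k. lift_affine (q k)"]
      by (simp add: g_def flip: scalar_mult_eq_scaleR)
  qed
  define z where "z = adjoint g 1"
  have gz: "g v = z \<bullet> v" for v
    using adjoint_works[OF \<open>linear g\<close>, of v 1] by (simp add: z_def inner_commute)
  have "simplex_det (q(i := y)) = g (lift_affine y)" for y
    unfolding simplex_det_def g_def by (rule arg_cong[of _ _ det]) (auto simp: vec_eq_iff)
  also have "g (lift_affine y) = (\<chi> j. z $ Some j) \<bullet> y + z $ None" for y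
    by (simp add: gz inner_vec_def sum_option lift_affine_def)
  finally show ?thesis by blast
qed

lemma simplex_det_eq_0:
  fixes q :: "'n option \<Rightarrow> real ^ 'n"
  assumes "q i = q j" "i \<noteq> j"
  shows "simplex_det q = 0"
  unfolding simplex_det_def
  by (rule det_identical_rows[OF assms(2)]) (simp add: assms row_def)

text \<open>In a linear relation between the lifted rows, the homogeneous coordinate says that the
  coefficients sum to 0, so linear independence of the rows is affine independence of the family.
  Injectivity is listed separately because \<open>range q\<close> forgets repetitions.\<close>

lemma simplex_det_nonzero_iff:
  fixes q :: "'n option \<Rightarrow> real ^ 'n"
  shows "simplex_det q \<noteq> 0 \<longleftrightarrow> inj q \<and> \<not> affine_dependent (range q)"
proof -
  have "simplex_det q \<noteq> 0 \<longleftrightarrow>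
    (\<forall>c. (\<Sum>i\<in>UNIV. c i *s lift_affine (q i)) = 0 \<longrightarrow> (\<forall>i. c i = 0))"
    unfolding simplex_det_def invertible_det_nz[symmetric] invertible_right_inverse
      matrix_right_invertible_independent_rows
    by (simp add: row_def vec_lambda_eta)
  also have "\<dots> \<longleftrightarrow> (\<forall>c. sum c UNIV = 0 \<and> (\<Sum>i\<in>UNIV. c i *\<^sub>R q i) = 0 \<longrightarrow> (\<forall>i. c i = 0))"
  proof -
    have "(\<Sum>i\<in>UNIV. c i *s lift_affine (q i)) = 0 \<longleftrightarrow>
        sum c UNIV = 0 \<and> (\<Sum>i\<in>UNIV. c i *\<^sub>R q i) = 0" for c
      unfolding vec_eq_iff split_option_all by (simp add: lift_affine_def)
    then show ?thesis by simp
  qed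
  also have "\<dots> \<longleftrightarrow> inj q \<and> \<not> affine_dependent (range q)" (is "?L \<longleftrightarrow> ?R")
  proof
    assume L: ?L
    have "inj q"
    proof (rule injI, rule ccontr)
      fix i j assume ij: "q i = q j" "i \<noteq> j"
      then have "simplex_det q = 0" by (rule simplex_det_eq_0)
      with L calculation show False by blast
    qed
    moreover have "\<not> affine_dependent (range q)"
    proof
      assume "affine_dependent (range q)"
      then obtain U where U: "sum U (range q) = 0" "\<exists>v\<in>range q. U v \<noteq> 0" "(\<Sum>v\<in>range q. U v *\<^sub>R v) = 0"
        by (auto simp: affine_dependent_explicit_finite)
      then have "sum (\<lambda>i. U (q i)) UNIV = 0" "(\<Sum>i\<in>UNIV. U (q i) *\<^sub>R q i) = 0"
        using \<open>inj q\<close> by (simp_all add: sum.reindex)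
      with L have "\<forall>i. U (q i) = 0" by blast
      with U show False by blast
    qed
    ultimately show ?R ..
  next
    assume R: ?R
    show ?L
    proof (intro allI impI, elim conjE)
      fix c i assume c: "sum c UNIV = 0" "(\<Sum>i\<in>UNIV. c i *\<^sub>R q i) = 0"
      then have "sum (\<lambda>v. c (inv q v)) (range q) = 0" "(\<Sum>v\<in>range q. c (inv q v) *\<^sub>R v) = 0"
        using R by (simp_all add: sum.reindex)
      with R have "\<forall>v\<in>range q. c (inv q v) = 0"
        by (auto simp: affine_dependent_explicit_finite)
      then show "c i = 0" using R by simp
    qed
  qed
  finally show ?thesis .
qed

lemma measurable_simplex_det [measurable (raw)]:
  fixes q :: "'a \<Rightarrow> 'n option \<Rightarrow> real ^ 'n"
  assumes [measurable]: "\<And>i. (\<lambda>a. q a i) \<in> borel_measurable M"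
  shows "(\<lambda>a. simplex_det (q a)) \<in> borel_measurable M"
proof -
  have "(\<lambda>a. lift_affine (q a i) $ j) \<in> borel_measurable M" for i j
    by (cases j) (auto simp: lift_affine_def intro!: measurable_compose[OF assms]
        borel_measurable_continuous_onI linear_continuous_on bounded_linear_vec_nth)
  then show ?thesis unfolding simplex_det_def det_def vec_lambda_beta by measurable
qed

section \<open>Fubini for a single point of the sample\<close>

abbreviation sphere_product :: "nat \<Rightarrow> (nat \<Rightarrow> real ^ 'n) measure" where
  "sphere_product m \<equiv> \<Pi>\<^sub>M i\<in>{1..m}. uniform_sphere"

lemma product_prob_space_uniform_sphere: "product_prob_space (\<lambda>_ :: nat. uniform_sphere :: (real ^ 'n) measure)"
proof -
  interpret prob_space "uniform_sphere :: (real ^ 'n) measure" by (rule prob_space_uniform_sphere)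
  show ?thesis by unfold_locales
qed

lemma product_sigma_finite_uniform_sphere:
  "product_sigma_finite (\<lambda>_ :: nat. uniform_sphere :: (real ^ 'n) measure)"
proof -
  interpret product_prob_space "\<lambda>_ :: nat. uniform_sphere :: (real ^ 'n) measure"
    by (rule product_prob_space_uniform_sphere)
  show ?thesis by unfold_locales
qed

lemma measurable_sphere_product_component:
  "j \<in> J \<Longrightarrow> (\<lambda>a. a j) \<in> borel_measurable (\<Pi>\<^sub>M i\<in>J. (uniform_sphere :: (real ^ 'n) measure))"
  using measurable_component_singleton[of j J "\<lambda>_. uniform_sphere :: (real ^ 'n) measure"]
  by (simp cong: measurable_cong_sets)

text \<open>Fubini in coordinate \<open>j\<close>. Since \<open>Q\<close> ignores that coordinate,
  it holds for almost every choice of the others, and for these \<open>P\<close> holds for almost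
  every value at \<open>j\<close>.\<close>

lemma AE_PiM_fun_upd:
  fixes P :: "(nat \<Rightarrow> real ^ 'n) \<Rightarrow> bool"
  assumes J: "finite J" "j \<in> J" and meas_P: "Measurable.pred (\<Pi>\<^sub>M i\<in>J. uniform_sphere) P"
    and Q: "AE a in (\<Pi>\<^sub>M i\<in>J. uniform_sphere). Q a" "Measurable.pred (\<Pi>\<^sub>M i\<in>J. uniform_sphere) Q"
      "\<And>a y. Q (a(j := y)) = Q a"
    and PQ: "\<And>a. Q a \<Longrightarrow> AE y in uniform_sphere. P (a(j := y))"
  shows "AE a in (\<Pi>\<^sub>M i\<in>J. uniform_sphere). P a"
proof -
  interpret product_prob_space "\<lambda>_ :: nat. uniform_sphere :: (real ^ 'n) measure"
    by (rule product_prob_space_uniform_sphere)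
  let ?M = "\<lambda>J. \<Pi>\<^sub>M i\<in>J. (uniform_sphere :: (real ^ 'n) measure)"
  define J' where "J' = J - {j}"
  have J': "finite J'" "j \<notin> J'" "insert j J' = J" using J by (auto simp: J'_def)
  have AE_iff: "(AE a in ?M J. R a) \<longleftrightarrow> (AE a in ?M J'. AE y in uniform_sphere. R (a(j := y)))"
    if [measurable]: "Measurable.pred (?M J) R" for R
  proof -
    have [measurable]: "Measurable.pred (?M (insert j J')) R" using that J' by simp
    have "(AE a in ?M J. R a) \<longleftrightarrow> (\<integral>\<^sup>+ a. indicator {a. \<not> R a} a \<partial>?M (insert j J')) = 0"
      unfolding J'(3) using that by (subst nn_integral_0_iff_AE) (auto simp: indicator_def)
    also have "\<dots> \<longleftrightarrow> (\<integral>\<^sup>+ a. (\<integral>\<^sup>+ y. indicator {a. \<not> R a} (a(j := y)) \<partial>uniform_sphere) \<partial>?M J') = 0"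
      using J' by (subst product_nn_integral_insert) auto
    also have "\<dots> \<longleftrightarrow> (AE a in ?M J'. (\<integral>\<^sup>+ y. indicator {a. \<not> R a} (a(j := y)) \<partial>uniform_sphere) = 0)"
      by (subst nn_integral_0_iff_AE) auto
    also have "\<dots> \<longleftrightarrow> (AE a in ?M J'. AE y in uniform_sphere. R (a(j := y)))"
    proof (intro AE_cong)
      fix a assume [measurable]: "a \<in> space (?M J')"
      show "(\<integral>\<^sup>+ y. indicator {a. \<not> R a} (a(j := y)) \<partial>uniform_sphere) = 0 \<longleftrightarrow>
          (AE y in uniform_sphere. R (a(j := y)))"
        by (subst nn_integral_0_iff_AE) (auto simp: indicator_def)
    qed
    finally show ?thesis .
  qed
  have "AE a in ?M J'. AE y in (uniform_sphere :: (real ^ 'n) measure). Q a"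
    using Q AE_iff[of Q] by simp
  then have "AE a in ?M J'. Q a"
    by (simp add: prob_space.AE_const[OF prob_space_uniform_sphere])
  then have "AE a in ?M J'. AE y in uniform_sphere. P (a(j := y))"
    using PQ by (auto elim: eventually_mono)
  then show ?thesis by (simp only: AE_iff[OF meas_P])
qed

lemma simplex_det_axes:
  "simplex_det (\<lambda>i. case i of None \<Rightarrow> 0 | Some j \<Rightarrow> (axis j 1 :: real ^ 'n)) \<noteq> 0" (is "simplex_det ?q \<noteq> 0")
proof -
  have inj: "inj (\<lambda>j. axis j (1 :: real) :: real ^ 'n)"
    by (rule injI) (simp add: axis_eq_axis)
  have r: "range ?q = insert 0 Basis"
    by (simp add: Basis_vec_def UNIV_option_conv image_image) auto
  have "inj ?q"
    using inj by (auto simp: inj_def axis_eq_0_iff split: option.splits)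
  moreover have "\<not> affine_dependent (insert 0 (Basis :: (real ^ 'n) set))"
    using affine_dependent_imp_dependent2 independent_Basis by blast
  ultimately show ?thesis by (simp add: simplex_det_nonzero_iff r)
qed

text \<open>
  A deterministic simplex is turned into the random one by replacing its vertices one at a time:
  the vertex being replaced is almost surely not on the hyperplane spanned by the others.
\<close>

lemma AE_simplex_det_nonzero:
  fixes q :: "'n :: finite option \<Rightarrow> nat"
  assumes n: "CARD('n) \<ge> 2" and q: "inj q" "\<And>i. q i \<le> m" and q0: "\<And>i. q i = 0 \<Longrightarrow> i = None"
  shows "AE a in sphere_product m. simplex_det (\<lambda>i. pt a (q i) :: real ^ 'n) \<noteq> 0"
proof -
  define e :: "'n option \<Rightarrow> real ^ 'n" where "e i = (case i of None \<Rightarrow> 0 | Some j \<Rightarrow> axis j 1)" for i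
  define mix where "mix K a = (\<lambda>i. if i \<in> K then a (q i) else e i)" for K a
  have me [measurable]: "(\<lambda>a. simplex_det (mix K a)) \<in> borel_measurable (sphere_product m)"
    if "K \<subseteq> {i. q i \<noteq> 0}" for K
    unfolding mix_def
  proof (intro measurable_simplex_det)
    fix i
    show "(\<lambda>a. if i \<in> K then a (q i) else e i) \<in> borel_measurable (sphere_product m)"
      using that q(2)[of i] by (cases "i \<in> K") (auto intro!: measurable_sphere_product_component)
  qed
  have "AE a in sphere_product m. simplex_det (mix K a) \<noteq> 0" if "finite K" "K \<subseteq> {i. q i \<noteq> 0}" for K
    using that
  proof (induction K rule: finite_induct)
    case empty
    then show ?case using simplex_det_axes[where 'n = 'n] by (simp add: mix_def e_def)
  next
    case (insert k K)
    have k: "q k \<in> {1..m}" using insert.prems q(2)[of k] by auto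
    show ?case
    proof (rule AE_PiM_fun_upd[where j = "q k" and Q = "\<lambda>a. simplex_det (mix K a) \<noteq> 0"])
      show "simplex_det (mix K (a(q k := y))) \<noteq> 0 \<longleftrightarrow> simplex_det (mix K a) \<noteq> 0" for a y
      proof -
        have "mix K (a(q k := y)) = mix K a"
          using insert.hyps injD[OF q(1)] by (auto simp: mix_def fun_eq_iff)
        then show ?thesis by simp
      qed
    next
      fix a assume nz: "simplex_det (mix K a) \<noteq> 0"
      obtain u w where uw: "\<And>y. simplex_det ((mix K a)(k := y)) = u \<bullet> y + w"
        using simplex_det_affine by blast
      \<comment> \<open>At the old vertex the affine function takes the previous, nonzero
        determinant as its value, so it is not identically zero.\<close>
      have "u \<noteq> 0 \<or> w \<noteq> 0" using nz uw[of "mix K a k"] by auto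
      moreover have "mix (insert k K) (a(q k := y)) = (mix K a)(k := y)" for y
        using injD[OF q(1)] by (auto simp: mix_def fun_eq_iff)
      ultimately show "AE y in uniform_sphere. simplex_det (mix (insert k K) (a(q k := y))) \<noteq> 0"
        using AE_uniform_sphere_notin_hyperplane[OF n] by (simp add: uw)
    qed (use insert k me in \<open>auto intro!: borel_measurable_neq\<close>)
  qed
  from this[of "{i. q i \<noteq> 0}"] have "AE a in sphere_product m. simplex_det (mix {i. q i \<noteq> 0} a) \<noteq> 0"
    by simp
  moreover have "mix {i. q i \<noteq> 0} a = (\<lambda>i. pt a (q i))" for a
    using q0 by (fastforce simp: mix_def e_def pt_def fun_eq_iff split: option.splits)
  ultimately show ?thesis by simp
qed

text \<open>As index 0 is the origin, this also keeps any n of the points from lying on a common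
  hyperplane through the origin.\<close>

definition general_position :: "nat \<Rightarrow> (nat \<Rightarrow> real ^ 'n) \<Rightarrow> bool" where
  "general_position m a \<longleftrightarrow> (\<forall>S \<subseteq> {0..m}. card S = CARD('n) + 1 \<longrightarrow>
     inj_on (pt a) S \<and> \<not> affine_dependent (pt a ` S))"

lemma AE_general_position:
  assumes n: "CARD('n) \<ge> 2"
  shows "AE a in sphere_product m. general_position m (a :: nat \<Rightarrow> real ^ 'n)"
proof -
  have "AE a in sphere_product m. inj_on (pt a) S \<and> \<not> affine_dependent (pt a ` S :: (real ^ 'n) set)"
    if S: "S \<subseteq> {0..m}" "card S = CARD('n) + 1" for S
  proof -
    have "finite S" using S by (auto intro: finite_subset)
    moreover have "card (UNIV :: 'n option set) = card S" using S by (simp add: card_UNIV_option)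
    ultimately obtain q0 :: "'n option \<Rightarrow> nat" where q0: "bij_betw q0 UNIV S"
      using finite_same_card_bij[of "UNIV :: 'n option set" S] by auto
    \<comment> \<open>Composing with a transposition moves the origin, if it occurs in
      \<open>S\<close>, to \<open>None\<close>, the only place allowed for it in
      \<open>AE_simplex_det_nonzero\<close>.\<close>
    define i0 where "i0 = (if 0 \<in> S then inv q0 0 else None)"
    define q where "q = q0 \<circ> Transposition.transpose None i0"
    have q: "bij_betw q UNIV S"
      unfolding q_def using bij_betw_trans[OF bij_transpose q0] by simp
    have "q i = 0 \<Longrightarrow> i = None" for i
    proof -
      assume "q i = 0"
      moreover then have "0 \<in> S" using q by (metis bij_betw_apply UNIV_I)
      then have "q None = 0"
        using q0 by (simp add: q_def i0_def bij_betw_def f_inv_into_f)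
      ultimately show "i = None" using q by (metis bij_betw_imp_inj_on injD)
    qed
    moreover have "q i \<le> m" for i using q S by (metis bij_betw_apply UNIV_I atLeastAtMost_iff subsetD)
    ultimately have "AE a in sphere_product m. simplex_det (\<lambda>i. pt a (q i) :: real ^ 'n) \<noteq> 0"
      using q by (intro AE_simplex_det_nonzero[OF n]) (auto simp: bij_betw_def)
    then show ?thesis
    proof eventually_elim
      case (elim a)
      then have "inj (pt a \<circ> q)" "\<not> affine_dependent (range (pt a \<circ> q))"
        by (auto simp: simplex_det_nonzero_iff comp_def)
      moreover have "range q = S" using q by (simp add: bij_betw_def)
      ultimately show ?case by (metis image_comp inj_on_imageI)
    qed
  qed
  then have "AE a in sphere_product m. \<forall>S \<in> {S. S \<subseteq> {0..m} \<and> card S = CARD('n) + 1}.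
      inj_on (pt a) S \<and> \<not> affine_dependent (pt a ` S :: (real ^ 'n) set)"
    by (intro AE_finite_allI) auto
  then show ?thesis by eventually_elim (auto simp: general_position_def)
qed

subsection \<open>Facets as index sets\<close>

definition index_simplex :: "(nat \<Rightarrow> real ^ 'n) \<Rightarrow> nat set \<Rightarrow> (real ^ 'n) set" where
  "index_simplex a I = convex hull (pt a ` I)"

text \<open>For n affinely independent points this is a fixed multiple of the signed distance from
  \<open>x\<close> to their hyperplane. The enumeration affects only the overall sign, which is why
  \<open>facet_index\<close> admits either sign.\<close>

definition side :: "(nat \<Rightarrow> real ^ 'n) \<Rightarrow> nat set \<Rightarrow> real ^ 'n \<Rightarrow> real" where
  "side a I x =
     (let e = SOME e :: 'n \<Rightarrow> nat. bij_betw e UNIV I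
      in simplex_det (\<lambda>i. case i of None \<Rightarrow> x | Some k \<Rightarrow> pt a (e k)))"

text \<open>
  Strict inequalities make the test fail for degenerate \<open>I\<close>, where \<open>side a I\<close> vanishes identically.
\<close>

definition facet_index :: "(nat \<Rightarrow> real ^ 'n) \<Rightarrow> nat \<Rightarrow> nat set \<Rightarrow> bool" where
  "facet_index a t I \<longleftrightarrow> I \<subseteq> {0..t} \<and> card I = CARD('n) \<and>
     ((\<forall>j\<in>{0..t} - I. side a I (pt a j) > 0) \<or> (\<forall>j\<in>{0..t} - I. side a I (pt a j) < 0))"

lemma finite_facet_index: "finite {I. facet_index a t I}"
  by (rule finite_subset[of _ "Pow {0..t}"]) (auto simp: facet_index_def)

text \<open>The enumeration depends on \<open>I\<close> alone, so one formula serves all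
  configurations \<open>a\<close> at once; measurability in \<open>a\<close> and
  \<open>side_cong\<close> rest on this uniformity.\<close>

lemma side_enum:
  assumes "card I = CARD('n :: finite)"
  obtains e :: "'n :: finite \<Rightarrow> nat" where "bij_betw e UNIV I"
    "\<And>(a :: nat \<Rightarrow> real ^ 'n) x.
       side a I x = simplex_det (\<lambda>i. case i of None \<Rightarrow> x | Some k \<Rightarrow> pt a (e k))"
proof -
  have "card I > 0" unfolding assms by simp
  then have "finite I" by (simp add: card_gt_0_iff)
  then have "\<exists>e :: 'n \<Rightarrow> nat. bij_betw e UNIV I"
    using assms finite_same_card_bij[of "UNIV :: 'n set" I] by auto
  then have "bij_betw (SOME e :: 'n \<Rightarrow> nat. bij_betw e UNIV I) UNIV I" by (rule someI_ex)
  then show ?thesis using that by (simp add: side_def)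
qed

lemma side_affine:
  fixes a :: "nat \<Rightarrow> real ^ 'n"
  assumes I: "card I = CARD('n)"
  obtains u w where "\<And>x. side a I x = u \<bullet> x + w" "\<And>i. i \<in> I \<Longrightarrow> u \<bullet> pt a i + w = 0"
proof -
  obtain e :: "'n \<Rightarrow> nat" where e: "bij_betw e UNIV I"
    "\<And>(a :: nat \<Rightarrow> real ^ 'n) x.
       side a I x = simplex_det (\<lambda>i. case i of None \<Rightarrow> x | Some k \<Rightarrow> pt a (e k))"
    using side_enum[OF I] by blast
  define q where "q = (\<lambda>i. case i of None \<Rightarrow> 0 | Some k \<Rightarrow> pt a (e k))"
  obtain u w where uw: "\<And>y. simplex_det (q(None := y)) = u \<bullet> y + w"
    using simplex_det_affine by blast
  have qn: "q(None := y) = (\<lambda>i. case i of None \<Rightarrow> y | Some k \<Rightarrow> pt a (e k))" for y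
    by (auto simp: q_def fun_eq_iff split: option.splits)
  have side: "side a I x = u \<bullet> x + w" for x using uw[of x] unfolding e(2) qn .
  moreover have "u \<bullet> pt a i + w = 0" if "i \<in> I" for i
  proof -
    have "i \<in> range e" using bij_betw_imp_surj_on[OF e(1)] that by simp
    then obtain k where k: "i = e k" by (rule rangeE)
    have "side a I (pt a i) = 0"
      unfolding e(2) by (rule simplex_det_eq_0[of _ None "Some k"]) (simp_all add: k)
    then show ?thesis using side by simp
  qed
  ultimately show ?thesis using that by blast
qed

lemma measurable_facet_index:
  assumes "t \<le> m"
  shows "Measurable.pred (sphere_product m) (\<lambda>a :: nat \<Rightarrow> real ^ 'n. facet_index a t I)"
proof (cases "I \<subseteq> {0..t} \<and> card I = CARD('n)")
  case True
  then obtain e :: "'n \<Rightarrow> nat" where e: "bij_betw e UNIV I"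
    "\<And>(a :: nat \<Rightarrow> real ^ 'n) x.
       side a I x = simplex_det (\<lambda>i. case i of None \<Rightarrow> x | Some k \<Rightarrow> pt a (e k))"
    using side_enum by blast
  have pt: "(\<lambda>a :: nat \<Rightarrow> real ^ 'n. pt a i) \<in> borel_measurable (sphere_product m)" if "i \<le> t" for i
    using that assms by (cases "i = 0") (auto simp: pt_def intro!: measurable_sphere_product_component)
  have "e k \<le> t" for k using e(1) True by (metis bij_betw_apply UNIV_I atLeastAtMost_iff subsetD)
  then have e_le: "\<And>k. e k \<le> t" .
  have [measurable]: "(\<lambda>a :: nat \<Rightarrow> real ^ 'n. side a I (pt a j)) \<in> borel_measurable (sphere_product m)"
    if "j \<in> {0..t} - I" for j
    unfolding e(2)
  proof (rule measurable_simplex_det)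
    fix i :: "'n option"
    show "(\<lambda>a :: nat \<Rightarrow> real ^ 'n. case i of None \<Rightarrow> pt a j | Some k \<Rightarrow> pt a (e k))
        \<in> borel_measurable (sphere_product m)"
      using that e_le pt by (cases i) simp_all
  qed
  show ?thesis unfolding facet_index_def by measurable
next
  case False
  then have "\<not> facet_index a t I" for a :: "nat \<Rightarrow> real ^ 'n"
    unfolding facet_index_def by blast
  then show ?thesis by simp
qed

section \<open>Faces of the polytope for points in general position\<close>

context
  fixes a :: "nat \<Rightarrow> real ^ 'n :: finite" and m :: nat
  assumes gp: "general_position m a" and m: "CARD('n) \<le> m"
begin

text \<open>General position speaks of exactly \<open>n + 1\<close> indices; because
  \<open>n \<le> m\<close>, a smaller set extends to such a set, and independence passes to
  subsets.\<close>

lemma gp_independent: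
  assumes "S \<subseteq> {0..m}" "card S \<le> CARD('n) + 1"
  shows "inj_on (pt a) S" "\<not> affine_dependent (pt a ` S)"
proof -
  obtain T where T: "S \<subseteq> T" "T \<subseteq> {0..m}" "card T = CARD('n) + 1"
    using exists_subset_between[of S "CARD('n) + 1" "{0..m}"] assms m by auto
  then have "inj_on (pt a) T" "\<not> affine_dependent (pt a ` T)"
    using gp by (auto simp: general_position_def)
  then show "inj_on (pt a) S" "\<not> affine_dependent (pt a ` S)"
    using T(1) affine_independent_subset[of "pt a ` T" "pt a ` S"] by (auto intro: inj_on_subset)
qed

lemma gp_notin_affine_hull:
  assumes "S \<subseteq> {0..m}" "card S \<le> CARD('n)" "j \<le> m" "j \<notin> S"
  shows "pt a j \<notin> affine hull (pt a ` S)"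
proof
  assume j: "pt a j \<in> affine hull (pt a ` S)"
  have "finite S" using assms by (auto intro: finite_subset)
  then have ins: "insert j S \<subseteq> {0..m}" "card (insert j S) \<le> CARD('n) + 1" using assms by auto
  have "pt a j \<notin> pt a ` S" using gp_independent(1)[OF ins] assms by (auto simp: inj_on_def)
  then have "affine_dependent (insert (pt a j) (pt a ` S))"
    using j by (auto simp: affine_dependent_def)
  then show False using gp_independent(2)[OF ins] by simp
qed

lemma gp_aff_dim:
  assumes "S \<subseteq> {0..m}" "card S \<le> CARD('n) + 1"
  shows "aff_dim (pt a ` S) = int (card S) - 1"
  using aff_dim_affine_independent[OF gp_independent(2)[OF assms]]
    card_image[OF gp_independent(1)[OF assms]] by simp

lemma affine_hull_eq_hyperplane:
  assumes S: "S \<subseteq> {0..m}" "card S = CARD('n)" and u: "u \<noteq> 0" "\<And>i. i \<in> S \<Longrightarrow> u \<bullet> pt a i = c"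
  shows "affine hull (pt a ` S) = {y. u \<bullet> y = c}"
proof -
  have "affine hull (pt a ` S) \<subseteq> {y. u \<bullet> y = c}"
    by (rule hull_minimal) (auto simp: u affine_hyperplane)
  moreover have "aff_dim (affine hull (pt a ` S)) = aff_dim {y. u \<bullet> y = c}"
    using gp_aff_dim[of S] S u(1) by (simp add: aff_dim_hyperplane)
  moreover have "S \<noteq> {}" using S(2) by auto
  ultimately show ?thesis
    by (intro affine_dim_equal) (auto simp: affine_hyperplane)
qed

text \<open>All other vertices avoid the affine hull of the points of \<open>I\<close>, so a simplex
  remembers its index set. Counts of facets and ridges become counts of index sets this way.\<close>

lemma index_simplex_inj:
  assumes "I \<subseteq> {0..m}" "J \<subseteq> {0..m}" "card I = card J" "card I \<le> CARD('n)"
    "index_simplex a I = index_simplex a J"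
  shows "I = J"
proof -
  have "J \<subseteq> I"
  proof
    fix j assume j: "j \<in> J"
    then have "pt a j \<in> index_simplex a I"
      unfolding assms(5) by (simp add: index_simplex_def hull_inc)
    then have "pt a j \<in> affine hull (pt a ` I)"
      using convex_hull_subset_affine_hull by (auto simp: index_simplex_def)
    moreover have "j \<le> m" using assms(2) j by auto
    ultimately show "j \<in> I" using gp_notin_affine_hull[OF assms(1,4)] by blast
  qed
  then show ?thesis using assms by (metis card_subset_eq finite_atLeastAtMost finite_subset)
qed

text \<open>The sign test by determinants is visibly measurable, while the supporting hyperplane is
  what the geometry uses. General position keeps \<open>side a I\<close> nonzero off
  \<open>I\<close>, and the two functionals vanish on the same hyperplane.\<close>

lemma facet_index_iff:
  assumes I: "I \<subseteq> {0..t}" "card I = CARD('n)" and t: "CARD('n) \<le> t" "t \<le> m"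
  shows "facet_index a t I \<longleftrightarrow>
    (\<exists>u c. u \<noteq> 0 \<and> (\<forall>i\<in>I. u \<bullet> pt a i = c) \<and> (\<forall>j\<le>t. u \<bullet> pt a j \<le> c))"
proof -
  obtain u w where uw: "\<And>x. side a I x = u \<bullet> x + w" "\<And>i. i \<in> I \<Longrightarrow> u \<bullet> pt a i + w = 0"
    using side_affine[OF I(2)] by blast
  have Im: "I \<subseteq> {0..m}" using I t by auto
  have nz: "side a I (pt a j) \<noteq> 0" if j: "j \<le> m" "j \<notin> I" for j
  proof -
    obtain e :: "'n \<Rightarrow> nat" where e: "bij_betw e UNIV I"
      "\<And>(a :: nat \<Rightarrow> real ^ 'n) x.
         side a I x = simplex_det (\<lambda>i. case i of None \<Rightarrow> x | Some k \<Rightarrow> pt a (e k))"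
      using side_enum[OF I(2)] by blast
    define q where "q = case_option j e"
    have iq: "inj q"
    proof (rule injI)
      fix x y assume "q x = q y"
      then show "x = y"
        using e(1) j by (cases x; cases y) (auto simp: q_def bij_betw_def inj_def)
    qed
    have rq: "range q = insert j I"
      using e(1) by (auto simp: q_def bij_betw_def UNIV_option_conv image_image)
    have "card (insert j I) \<le> CARD('n) + 1" using I(2) j(2) finite_subset[OF I(1)] by simp
    then have ind: "inj_on (pt a) (range q)" "\<not> affine_dependent (pt a ` range q)"
      using gp_independent[of "insert j I"] Im j(1) unfolding rq by auto
    have "inj (pt a \<circ> q)" by (rule comp_inj_on[OF iq ind(1)])
    moreover have "\<not> affine_dependent (range (pt a \<circ> q))" using ind(2) by (simp add: image_comp)
    ultimately have "simplex_det (pt a \<circ> q) \<noteq> 0" unfolding simplex_det_nonzero_iff by blast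
    moreover have "pt a \<circ> q = (\<lambda>i. case i of None \<Rightarrow> pt a j | Some k \<Rightarrow> pt a (e k))"
      by (auto simp: q_def fun_eq_iff split: option.splits)
    ultimately show ?thesis by (simp add: e(2))
  qed
  \<comment> \<open>As \<open>n \<le> t\<close>, there are more than n indices, so some tested point
    lies off the hyperplane; its nonzero value excludes \<open>u = 0\<close>.\<close>
  have "card I \<noteq> card {0..t}" using I t by simp
  then obtain j0 where j0: "j0 \<le> t" "j0 \<notin> I" using I by (metis atLeastAtMost_iff subset_antisym subsetI)
  have "card I \<noteq> 0" unfolding I by simp
  then obtain i0 where i0: "i0 \<in> I" by fastforce
  have u0: "u \<noteq> 0"
    using nz[of j0] j0 t uw(1) uw(2)[OF i0] by auto
  show ?thesis
  proof
    assume "facet_index a t I"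
    then consider "\<forall>j\<in>{0..t} - I. u \<bullet> pt a j + w > 0" | "\<forall>j\<in>{0..t} - I. u \<bullet> pt a j + w < 0"
      by (auto simp: facet_index_def uw(1))
    then show "\<exists>u c. u \<noteq> 0 \<and> (\<forall>i\<in>I. u \<bullet> pt a i = c) \<and> (\<forall>j\<le>t. u \<bullet> pt a j \<le> c)"
    proof cases
      case 1
      have "- u \<bullet> pt a j \<le> w" if "j \<le> t" for j
        using 1 uw(2)[of j] that by (cases "j \<in> I") (auto simp: le_less dest!: bspec[of _ _ j])
      moreover have "- u \<bullet> pt a i = w" if "i \<in> I" for i using uw(2)[OF that] by simp
      ultimately show ?thesis using u0 by (intro exI[of _ "-u"] exI[of _ w]) auto
    next
      case 2
      have "u \<bullet> pt a j \<le> - w" if "j \<le> t" for j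
        using 2 uw(2)[of j] that by (cases "j \<in> I") (auto simp: le_less dest!: bspec[of _ _ j])
      moreover have "u \<bullet> pt a i = - w" if "i \<in> I" for i using uw(2)[OF that] by simp
      ultimately show ?thesis using u0 by (intro exI[of _ u] exI[of _ "-w"]) auto
    qed
  next
    assume "\<exists>u c. u \<noteq> 0 \<and> (\<forall>i\<in>I. u \<bullet> pt a i = c) \<and> (\<forall>j\<le>t. u \<bullet> pt a j \<le> c)"
    then obtain v c where v: "v \<noteq> 0" "\<And>i. i \<in> I \<Longrightarrow> v \<bullet> pt a i = c" "\<And>j. j \<le> t \<Longrightarrow> v \<bullet> pt a j \<le> c"
      by blast
    have h1: "affine hull (pt a ` I) = {y. v \<bullet> y = c}"
      by (rule affine_hull_eq_hyperplane[OF Im I(2) v(1,2)])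
    have h2: "affine hull (pt a ` I) = {y. u \<bullet> y = - w}"
      by (rule affine_hull_eq_hyperplane[OF Im I(2) u0]) (use uw(2) in force)
    have strict: "v \<bullet> pt a j < c" if "j \<le> t" "j \<notin> I" for j
    proof -
      have "pt a j \<notin> affine hull (pt a ` I)"
        using gp_notin_affine_hull[OF Im _ _ that(2)] I that t by simp
      then show ?thesis using v(3)[OF that(1)] by (simp add: h1)
    qed
    have same: False if j: "j \<le> t" "j \<notin> I" "side a I (pt a j) > 0"
      and k: "k \<le> t" "k \<notin> I" "side a I (pt a k) < 0" for j k
    proof -
      define p q where "p = side a I (pt a j)" and "q = - side a I (pt a k)"
      have pq: "p > 0" "q > 0" using j k by (auto simp: p_def q_def)
      have p': "u \<bullet> pt a j = p - w" and q': "u \<bullet> pt a k = - q - w"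
        using uw(1) by (simp_all add: p_def q_def)
      \<comment> \<open>The point of the segment where \<open>side a I\<close> vanishes. It would
        lie on the supporting hyperplane although both endpoints are strictly on one side of
        it.\<close>
      define z where "z = (q / (p + q)) *\<^sub>R pt a j + (p / (p + q)) *\<^sub>R pt a k"
      have "u \<bullet> z = (q * (p - w) + p * (- q - w)) / (p + q)"
        by (simp add: z_def inner_add_right p' q' add_divide_distrib)
      also have "\<dots> = (- w) * (p + q) / (p + q)" by (simp add: algebra_simps)
      also have "\<dots> = - w" using pq by simp
      finally have "u \<bullet> z = - w" .
      then have "v \<bullet> z = c" using h1 h2 by blast
      moreover have "v \<bullet> z < (q / (p + q)) * c + (p / (p + q)) * c"
        unfolding z_def inner_add_right inner_scaleR_right
        using pq strict[OF j(1,2)] strict[OF k(1,2)]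
        by (intro add_strict_mono mult_strict_left_mono) auto
      moreover have "(q / (p + q)) * c + (p / (p + q)) * c = c"
        using pq by (simp add: add.commute[of q p] flip: distrib_right add_divide_distrib)
      ultimately show False by simp
    qed
    then have "(\<forall>j\<in>{0..t} - I. side a I (pt a j) > 0) \<or> (\<forall>j\<in>{0..t} - I. side a I (pt a j) < 0)"
      using nz t by (smt (verit) Diff_iff atLeastAtMost_iff order_trans)
    then show "facet_index a t I" using I by (simp add: facet_index_def)
  qed
qed

lemma bb_polytope_eq: "bb_polytope a t = convex hull (pt a ` {0..t})"
proof -
  have "{0..t} = insert 0 {1..t}" by auto
  then have "pt a ` {0..t} = insert (pt a 0) (pt a ` {1..t})" by (simp only: image_insert)
  also have "pt a ` {1..t} = a ` {1..t}" by (rule image_cong) (auto simp: pt_def)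
  finally show ?thesis by (simp add: bb_polytope_def pt_def)
qed

lemma bb_polytope_subset_halfspace_iff:
  "bb_polytope a t \<subseteq> {y. u \<bullet> y \<le> c} \<longleftrightarrow> (\<forall>j\<le>t. u \<bullet> pt a j \<le> c)"
proof
  assume "bb_polytope a t \<subseteq> {y. u \<bullet> y \<le> c}"
  moreover have "pt a ` {0..t} \<subseteq> bb_polytope a t"
    by (simp add: bb_polytope_eq hull_subset)
  ultimately have "pt a ` {0..t} \<subseteq> {y. u \<bullet> y \<le> c}" by (rule order_trans[rotated])
  then show "\<forall>j\<le>t. u \<bullet> pt a j \<le> c" by (simp add: image_subset_iff)
next
  assume "\<forall>j\<le>t. u \<bullet> pt a j \<le> c"
  then show "bb_polytope a t \<subseteq> {y. u \<bullet> y \<le> c}"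
    unfolding bb_polytope_eq by (intro hull_minimal) (auto simp: convex_halfspace_le)
qed

lemma aff_dim_bb_polytope:
  assumes "CARD('n) \<le> t" "t \<le> m"
  shows "aff_dim (bb_polytope a t) = int CARD('n)"
proof (rule antisym)
  have "int CARD('n) = aff_dim (pt a ` {0..CARD('n)})"
    using gp_aff_dim[of "{0..CARD('n)}"] assms by simp
  also have "\<dots> \<le> aff_dim (pt a ` {0..t})"
    using assms by (intro aff_dim_subset image_mono) auto
  finally show "int CARD('n) \<le> aff_dim (bb_polytope a t)"
    by (simp add: bb_polytope_eq aff_dim_convex_hull)
  show "aff_dim (bb_polytope a t) \<le> int CARD('n)"
    using aff_dim_le_DIM[of "bb_polytope a t"] by simp
qed

text \<open>Faces of a convex hull are hulls of subsets of the points, and dimension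
  \<open>n - 1\<close> forces n of them. Conversely, the supporting hyperplane contains no points
  outside \<open>I\<close>, so the face it cuts out is exactly the simplex on
  \<open>I\<close>.\<close>

lemma facet_of_bb_polytope_iff:
  assumes t: "CARD('n) \<le> t" "t \<le> m"
  shows "F facet_of bb_polytope a t \<longleftrightarrow> (\<exists>I. facet_index a t I \<and> F = index_simplex a I)"
proof
  assume F: "F facet_of bb_polytope a t"
  then have face: "F face_of bb_polytope a t" and "F \<noteq> {}"
    and dimF: "aff_dim F = int CARD('n) - 1"
    using aff_dim_bb_polytope[OF t] by (auto simp: facet_of_def)
  obtain S where S: "S \<subseteq> pt a ` {0..t}" "F = convex hull S"
    using face face_of_convex_hull_subset[of "pt a ` {0..t}" F]
    by (auto simp: bb_polytope_eq finite_imp_compact)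
  then obtain I where I: "I \<subseteq> {0..t}" "S = pt a ` I" by (auto simp: subset_image_iff)
  have Im: "I \<subseteq> {0..m}" using I t by auto
  have "finite I" using I by (auto intro: finite_subset)
  have cI: "card I = CARD('n)"
  proof (cases "card I \<le> CARD('n) + 1")
    case True
    then show ?thesis using gp_aff_dim[OF Im] dimF S I by (simp add: aff_dim_convex_hull)
  next
    case False
    then have "CARD('n) + 1 \<le> card I" by linarith
    then obtain J where J: "J \<subseteq> I" "card J = CARD('n) + 1" by (rule obtain_subset_with_card_n)
    have "J \<subseteq> {0..m}" using J(1) Im by blast
    then have "int CARD('n) = aff_dim (pt a ` J)" using gp_aff_dim[of J] J(2) by simp
    also have "\<dots> \<le> aff_dim F"
      unfolding S I aff_dim_convex_hull by (intro aff_dim_subset image_mono J(1))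
    finally have False using dimF by linarith
    then show ?thesis ..
  qed
  have "polytope (bb_polytope a t)" by (auto simp: polytope_def bb_polytope_eq)
  then have "F exposed_face_of bb_polytope a t"
    using face by (simp add: exposed_face_of_polyhedron polytope_imp_polyhedron)
  then obtain u c where uc: "bb_polytope a t \<subseteq> {y. u \<bullet> y \<le> c}" "F = bb_polytope a t \<inter> {y. u \<bullet> y = c}"
    by (auto simp: exposed_face_of_def)
  have "u \<noteq> 0"
  proof
    assume "u = 0"
    with uc \<open>F \<noteq> {}\<close> have "F = bb_polytope a t" by auto
    then show False using dimF aff_dim_bb_polytope[OF t] by simp
  qed
  moreover have "\<forall>i\<in>I. u \<bullet> pt a i = c"
    using uc(2) hull_subset[of S convex] by (auto simp: S I)
  moreover have "\<forall>j\<le>t. u \<bullet> pt a j \<le> c"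
    using uc(1) by (simp add: bb_polytope_subset_halfspace_iff)
  ultimately have "facet_index a t I" using facet_index_iff[OF I(1) cI t] by blast
  then show "\<exists>I. facet_index a t I \<and> F = index_simplex a I"
    using S I by (auto simp: index_simplex_def)
next
  assume "\<exists>I. facet_index a t I \<and> F = index_simplex a I"
  then obtain I where fI: "facet_index a t I" and F: "F = index_simplex a I" by blast
  then have I: "I \<subseteq> {0..t}" "card I = CARD('n)" by (auto simp: facet_index_def)
  have Im: "I \<subseteq> {0..m}" using I t by auto
  obtain u c where u: "u \<noteq> 0" "\<And>i. i \<in> I \<Longrightarrow> u \<bullet> pt a i = c" "\<forall>j\<le>t. u \<bullet> pt a j \<le> c"
    using fI facet_index_iff[OF I t] by blast
  have P: "bb_polytope a t \<subseteq> {y. u \<bullet> y \<le> c}"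
    using u by (simp add: bb_polytope_subset_halfspace_iff)
  define G where "G = bb_polytope a t \<inter> {y. u \<bullet> y = c}"
  have G: "G face_of bb_polytope a t"
    unfolding G_def using P
    by (intro face_of_Int_supporting_hyperplane_le) (auto simp: bb_polytope_eq)
  have hyp: "affine hull (pt a ` I) = {y. u \<bullet> y = c}"
    by (rule affine_hull_eq_hyperplane[OF Im I(2) u(1,2)])
  obtain S where S: "S \<subseteq> pt a ` {0..t}" "G = convex hull S"
    using G face_of_convex_hull_subset[of "pt a ` {0..t}" G]
    by (auto simp: bb_polytope_eq finite_imp_compact)
  have "S \<subseteq> pt a ` I"
  proof
    fix x assume x: "x \<in> S"
    then obtain j where j: "x = pt a j" "j \<le> t" using S by auto
    have "x \<in> G" using x S by (simp add: hull_inc)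
    then have "x \<in> affine hull (pt a ` I)" by (simp add: hyp G_def)
    then have "j \<in> I" using gp_notin_affine_hull[OF Im, of j] j I t by auto
    then show "x \<in> pt a ` I" using j by simp
  qed
  then have "G \<subseteq> F" unfolding S(2) F index_simplex_def by (rule hull_mono)
  moreover have "F \<subseteq> G"
    unfolding F index_simplex_def
  proof (rule hull_minimal)
    show "pt a ` I \<subseteq> G"
      using I u(2) by (auto simp: G_def bb_polytope_eq intro!: hull_inc)
    show "convex G" using G face_of_imp_convex by blast
  qed
  ultimately have "F = G" by simp
  moreover have "aff_dim F = int CARD('n) - 1"
    using gp_aff_dim[OF Im] I by (simp add: F index_simplex_def aff_dim_convex_hull)
  moreover have "F \<noteq> {}" using I by (auto simp: F index_simplex_def)
  ultimately show "F facet_of bb_polytope a t"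
    using G aff_dim_bb_polytope[OF t] by (simp add: facet_of_def)
qed

text \<open>If the new point is on the same side, the hyperplane of the facet still supports the
  enlarged polytope. The test for removal thus becomes \<open>facet_index\<close> at the next
  time.\<close>

lemma same_side_index_simplex_iff:
  assumes fI: "facet_index a t I" and t: "CARD('n) \<le> t" "Suc t \<le> m"
  shows "same_side (bb_polytope a t) (index_simplex a I) (a (Suc t)) \<longleftrightarrow> facet_index a (Suc t) I"
proof -
  have I: "I \<subseteq> {0..t}" "card I = CARD('n)" using fI by (auto simp: facet_index_def)
  then have Im: "I \<subseteq> {0..m}" "I \<subseteq> {0..Suc t}" using t by auto
  have pt: "pt a (Suc t) = a (Suc t)" by (simp add: pt_def)
  have hull: "affine hull (index_simplex a I) = affine hull (pt a ` I)"
    by (simp add: index_simplex_def)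
  have "same_side (bb_polytope a t) (index_simplex a I) (a (Suc t)) \<longleftrightarrow>
     (\<exists>u c. u \<noteq> 0 \<and> affine hull (pt a ` I) = {y. u \<bullet> y = c} \<and> (\<forall>j\<le>Suc t. u \<bullet> pt a j \<le> c))"
    unfolding same_side_def hull bb_polytope_subset_halfspace_iff pt[symmetric]
    by (auto simp: le_Suc_eq)
  also have "\<dots> \<longleftrightarrow>
     (\<exists>u c. u \<noteq> 0 \<and> (\<forall>i\<in>I. u \<bullet> pt a i = c) \<and> (\<forall>j\<le>Suc t. u \<bullet> pt a j \<le> c))"
  proof -
    have "affine hull (pt a ` I) = {y. u \<bullet> y = c} \<longleftrightarrow> (\<forall>i\<in>I. u \<bullet> pt a i = c)" if "u \<noteq> 0" for u c
      using affine_hull_eq_hyperplane[OF Im(1) I(2) that, of c] hull_subset[of "pt a ` I" affine]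
      by blast
    then show ?thesis by (simp cong: conj_cong)
  qed
  also have "\<dots> \<longleftrightarrow> facet_index a (Suc t) I"
    using facet_index_iff[OF Im(2) I(2)] t by simp
  finally show ?thesis .
qed

text \<open>Faces of a simplex correspond to subsets of its vertices, so a ridge arises by omitting
  one vertex. The second part makes each removed facet cost exactly \<open>n\<close> ridge
  operations.\<close>

lemma ridges_index_simplex:
  assumes I: "I \<subseteq> {0..m}" "card I = CARD('n)"
  shows "ridges (index_simplex a I) = (\<lambda>i. index_simplex a (I - {i})) ` I"
    and "card (ridges (index_simplex a I)) = CARD('n)"
proof -
  have fin: "finite I" using I by (auto intro: finite_subset)
  have dim: "aff_dim (index_simplex a J) = int (card J) - 1" if "J \<subseteq> I" for J
  proof -
    have "card J \<le> card I" using that fin by (rule card_mono[rotated])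
    then show ?thesis using gp_aff_dim[of J] that I by (simp add: index_simplex_def aff_dim_convex_hull)
  qed
  have "R \<in> ridges (index_simplex a I) \<longleftrightarrow> (\<exists>i\<in>I. R = index_simplex a (I - {i}))" for R
  proof -
    have "R face_of index_simplex a I \<longleftrightarrow> (\<exists>J\<subseteq>I. R = index_simplex a J)"
      using face_of_convex_hull_affine_independent[OF gp_independent(2)[of I], of R] I
      by (auto simp: index_simplex_def subset_image_iff)
    then have "R \<in> ridges (index_simplex a I) \<longleftrightarrow>
        (\<exists>J\<subseteq>I. card J + 1 = card I \<and> R = index_simplex a J)"
      using I by (auto simp: ridges_def dim)
    also have "\<dots> \<longleftrightarrow> (\<exists>i\<in>I. R = index_simplex a (I - {i}))"
    proof
      assume "\<exists>J\<subseteq>I. card J + 1 = card I \<and> R = index_simplex a J"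
      then obtain J where J: "J \<subseteq> I" "card J + 1 = card I" "R = index_simplex a J" by blast
      then have "card (I - J) = 1" using fin by (simp add: card_Diff_subset finite_subset)
      then obtain i where "I - J = {i}" by (auto simp: card_1_singleton_iff)
      then have "i \<in> I" "J = I - {i}" using J by auto
      then show "\<exists>i\<in>I. R = index_simplex a (I - {i})" using J by blast
    next
      assume "\<exists>i\<in>I. R = index_simplex a (I - {i})"
      then obtain i where i: "i \<in> I" "R = index_simplex a (I - {i})" by blast
      then have "card (I - {i}) + 1 = card I" using card_Suc_Diff1[OF fin i(1)] by simp
      then show "\<exists>J\<subseteq>I. card J + 1 = card I \<and> R = index_simplex a J"
        by (intro exI[of _ "I - {i}"] conjI i(2) Diff_subset)
    qed
    finally show ?thesis .
  qed
  then show *: "ridges (index_simplex a I) = (\<lambda>i. index_simplex a (I - {i})) ` I" by blast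
  have "inj_on (\<lambda>i. index_simplex a (I - {i})) I"
  proof (rule inj_onI)
    fix i j assume ij: "i \<in> I" "j \<in> I" "index_simplex a (I - {i}) = index_simplex a (I - {j})"
    have "I - {i} = I - {j}"
      by (rule index_simplex_inj[OF _ _ _ _ ij(3)]) (use I ij fin in auto)
    then show "i = j" using ij by blast
  qed
  then show "card (ridges (index_simplex a I)) = CARD('n)"
    unfolding * using I by (simp add: card_image)
qed

end

subsection \<open>The algorithm on index sets\<close>

text \<open>
  The algorithm on index sets. It depends on the points only through finitely many tests
  \<open>facet_index a t I\<close>, which gives the measurability of the cost.
\<close>

primrec algorithm_indices :: "(nat \<Rightarrow> nat set \<Rightarrow> bool) \<Rightarrow> nat \<Rightarrow> nat \<Rightarrow> nat set set" where
  "algorithm_indices P n 0 = {I. P n I}"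
| "algorithm_indices P n (Suc k) =
     {I \<in> algorithm_indices P n k. P (Suc (n + k)) I} \<union>
     {J. P (Suc (n + k)) J \<and> (\<exists>I \<in> algorithm_indices P n k. \<not> P (Suc (n + k)) I \<and>
           (\<exists>i\<in>I. J = insert (Suc (n + k)) (I - {i})))}"

text \<open>A kept or added index set has passed the test at the current time. This inclusion bounds
  the length of the list by the number of facets of the polytope.\<close>

lemma algorithm_indices_subset: "algorithm_indices P n k \<subseteq> {I. P (n + k) I}"
  by (cases k) auto

definition algorithm_cost :: "(nat \<Rightarrow> nat set \<Rightarrow> bool) \<Rightarrow> nat \<Rightarrow> nat \<Rightarrow> nat" where
  "algorithm_cost P n m = (\<Sum>k<m - n. card (algorithm_indices P n k) +
     (1 + n) * card {I \<in> algorithm_indices P n k. \<not> P (Suc (n + k)) I})"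

text \<open>By induction, each geometric operation has its combinatorial counterpart: keeping is the
  test at the next time, and the cone over the ridge without vertex \<open>i\<close> exchanges
  \<open>i\<close> for the new index.\<close>

lemma bb_facets_eq:
  fixes a :: "nat \<Rightarrow> real ^ 'n"
  assumes gp: "general_position m a" and k: "CARD('n) + k \<le> m"
  shows "bb_facets a k = index_simplex a ` algorithm_indices (facet_index a) CARD('n) k"
  using k
proof (induction k)
  case 0
  then show ?case using facet_of_bb_polytope_iff[OF gp, of "CARD('n)"] by auto
next
  case (Suc k)
  define t where "t = CARD('n) + k"
  define L where "L = algorithm_indices (facet_index a) CARD('n) k"
  have t: "CARD('n) \<le> t" "Suc t \<le> m" and m: "CARD('n) \<le> m" using Suc.prems by (auto simp: t_def)
  have IH: "bb_facets a k = index_simplex a ` L" using Suc by (simp add: L_def)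
  have L: "facet_index a t I" if "I \<in> L" for I
    using that algorithm_indices_subset[of "facet_index a" "CARD('n)" k] by (auto simp: L_def t_def)
  have side: "same_side (bb_polytope a t) (index_simplex a I) (a (Suc t)) \<longleftrightarrow> facet_index a (Suc t) I"
    if "I \<in> L" for I using same_side_index_simplex_iff[OF gp m L[OF that] t] .
  have removed: "bb_removed a t (bb_facets a k) = index_simplex a ` {I \<in> L. \<not> facet_index a (Suc t) I}"
    unfolding bb_removed_def IH using side by auto
  have kept: "bb_facets a k - bb_removed a t (bb_facets a k) = index_simplex a ` {I \<in> L. facet_index a (Suc t) I}"
    unfolding bb_removed_def IH using side by auto
  have cone: "convex hull insert (a (Suc t)) (index_simplex a J) = index_simplex a (insert (Suc t) J)" for J
    using hull_insert[of convex "a (Suc t)" "pt a ` J"] by (simp add: index_simplex_def pt_def)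
  \<comment> \<open>Being a facet yields some index set \<open>K\<close> for the cone;
    \<open>index_simplex_inj\<close> identifies it with the expected one, once the exchange of a
    vertex is seen to preserve the cardinality.\<close>
  have facet: "index_simplex a (insert (Suc t) (I - {i})) facet_of bb_polytope a (Suc t) \<longleftrightarrow>
      facet_index a (Suc t) (insert (Suc t) (I - {i}))" if I: "I \<in> L" "i \<in> I" for I i
  proof
    assume "index_simplex a (insert (Suc t) (I - {i})) facet_of bb_polytope a (Suc t)"
    then obtain K where K: "facet_index a (Suc t) K"
      "index_simplex a (insert (Suc t) (I - {i})) = index_simplex a K"
      using facet_of_bb_polytope_iff[OF gp m, of "Suc t"] t by auto
    have I': "I \<subseteq> {0..t}" "card I = CARD('n)" using L[OF I(1)] by (auto simp: facet_index_def)
    have "finite I" using I' by (auto intro: finite_subset)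
    have "card (insert (Suc t) (I - {i})) = Suc (card (I - {i}))"
      using I' \<open>finite I\<close> by (intro card_insert_disjoint) auto
    also have "\<dots> = CARD('n)" using card_Suc_Diff1[OF \<open>finite I\<close> I(2)] I' by simp
    finally have c: "card (insert (Suc t) (I - {i})) = CARD('n)" .
    have "insert (Suc t) (I - {i}) = K"
    proof (rule index_simplex_inj[OF gp m _ _ _ _ K(2)])
      show "insert (Suc t) (I - {i}) \<subseteq> {0..m}" using I' t by auto
      show "K \<subseteq> {0..m}" using K(1) t by (auto simp: facet_index_def)
    qed (use c K(1) in \<open>auto simp: facet_index_def\<close>)
    then show "facet_index a (Suc t) (insert (Suc t) (I - {i}))" using K by simp
  next
    assume "facet_index a (Suc t) (insert (Suc t) (I - {i}))"
    then show "index_simplex a (insert (Suc t) (I - {i})) facet_of bb_polytope a (Suc t)"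
      using facet_of_bb_polytope_iff[OF gp m, of "Suc t"] t by auto
  qed
  have ridges: "ridges (index_simplex a I) = (\<lambda>i. index_simplex a (I - {i})) ` I" if "I \<in> L" for I
  proof -
    have "I \<subseteq> {0..m}" "card I = CARD('n)" using L[OF that] t by (auto simp: facet_index_def)
    then show ?thesis by (rule ridges_index_simplex(1)[OF gp m])
  qed
  have "G \<in> bb_new a t (bb_facets a k) \<longleftrightarrow>
      (\<exists>I\<in>L. \<not> facet_index a (Suc t) I \<and> (\<exists>i\<in>I. G = index_simplex a (insert (Suc t) (I - {i})) \<and>
         facet_index a (Suc t) (insert (Suc t) (I - {i}))))" for G
  proof -
    have "G \<in> bb_new a t (bb_facets a k) \<longleftrightarrow>
      (\<exists>I\<in>L. \<not> facet_index a (Suc t) I \<and> (\<exists>R \<in> ridges (index_simplex a I).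
         G = convex hull insert (a (Suc t)) R \<and> G facet_of bb_polytope a (Suc t)))"
      unfolding bb_new_def removed by blast
    also have "\<dots> \<longleftrightarrow> (\<exists>I\<in>L. \<not> facet_index a (Suc t) I \<and> (\<exists>i\<in>I.
         G = index_simplex a (insert (Suc t) (I - {i})) \<and> G facet_of bb_polytope a (Suc t)))"
      by (intro bex_cong refl) (simp add: ridges cone)
    also have "\<dots> \<longleftrightarrow> (\<exists>I\<in>L. \<not> facet_index a (Suc t) I \<and> (\<exists>i\<in>I.
         G = index_simplex a (insert (Suc t) (I - {i})) \<and>
         facet_index a (Suc t) (insert (Suc t) (I - {i}))))"
      using facet by (intro bex_cong conj_cong refl) auto
    finally show ?thesis .
  qed
  then have new: "bb_new a t (bb_facets a k) = index_simplex a `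
      {J. facet_index a (Suc t) J \<and> (\<exists>I\<in>L. \<not> facet_index a (Suc t) I \<and>
        (\<exists>i\<in>I. J = insert (Suc t) (I - {i})))}"
  proof (intro set_eqI iffI)
    fix G assume *: "\<And>G. G \<in> bb_new a t (bb_facets a k) \<longleftrightarrow>
      (\<exists>I\<in>L. \<not> facet_index a (Suc t) I \<and> (\<exists>i\<in>I. G = index_simplex a (insert (Suc t) (I - {i})) \<and>
         facet_index a (Suc t) (insert (Suc t) (I - {i}))))"
    {
      assume "G \<in> bb_new a t (bb_facets a k)"
      then obtain I i where "I \<in> L" "\<not> facet_index a (Suc t) I" "i \<in> I"
        "G = index_simplex a (insert (Suc t) (I - {i}))" "facet_index a (Suc t) (insert (Suc t) (I - {i}))"
        unfolding * by blast
      then show "G \<in> index_simplex a `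
        {J. facet_index a (Suc t) J \<and> (\<exists>I\<in>L. \<not> facet_index a (Suc t) I \<and>
          (\<exists>i\<in>I. J = insert (Suc t) (I - {i})))}"
        by (intro image_eqI[of G _ "insert (Suc t) (I - {i})"]) auto
    }
    assume "G \<in> index_simplex a `
      {J. facet_index a (Suc t) J \<and> (\<exists>I\<in>L. \<not> facet_index a (Suc t) I \<and>
        (\<exists>i\<in>I. J = insert (Suc t) (I - {i})))}"
    then obtain I i where "I \<in> L" "\<not> facet_index a (Suc t) I" "i \<in> I"
        "G = index_simplex a (insert (Suc t) (I - {i}))" "facet_index a (Suc t) (insert (Suc t) (I - {i}))"
      by blast
    then show "G \<in> bb_new a t (bb_facets a k)" unfolding * by blast
  qed
  show ?case
    by (simp only: bb_facets.simps algorithm_indices.simps image_Un flip: t_def L_def)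
      (simp only: kept new)
qed

lemma bb_complexity_eq:
  fixes a :: "nat \<Rightarrow> real ^ 'n"
  assumes gp: "general_position m a" and m: "CARD('n) \<le> m"
  shows "bb_complexity m a = algorithm_cost (facet_index a) CARD('n) m"
  unfolding bb_complexity_def algorithm_cost_def
proof (rule sum.cong)
  fix k assume "k \<in> {..<m - CARD('n)}"
  then have k: "CARD('n) + k \<le> m" "Suc (CARD('n) + k) \<le> m" by auto
  define t where "t = CARD('n) + k"
  define L where "L = algorithm_indices (facet_index a) CARD('n) k"
  define D where "D = {I \<in> L. \<not> facet_index a (Suc t) I}"
  have t: "CARD('n) \<le> t" "Suc t \<le> m" using k by (auto simp: t_def)
  have F: "bb_facets a k = index_simplex a ` L" unfolding L_def by (rule bb_facets_eq[OF gp k(1)])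
  have L: "facet_index a t I" if "I \<in> L" for I
    using that algorithm_indices_subset[of "facet_index a" "CARD('n)" k] by (auto simp: L_def t_def)
  then have LI: "I \<subseteq> {0..m}" "card I = CARD('n)" if "I \<in> L" for I
    using that t by (force simp: facet_index_def)+
  have inj: "inj_on (index_simplex a) L"
    by (rule inj_onI) (rule index_simplex_inj[OF gp m], auto simp: LI)
  have "same_side (bb_polytope a t) (index_simplex a I) (a (Suc t)) \<longleftrightarrow> facet_index a (Suc t) I"
    if "I \<in> L" for I using same_side_index_simplex_iff[OF gp m L[OF that] t] .
  then have removed: "bb_removed a t (bb_facets a k) = index_simplex a ` D"
    unfolding bb_removed_def F D_def by auto
  have injD: "inj_on (index_simplex a) D" using inj by (rule inj_on_subset) (auto simp: D_def)
  have "(\<Sum>F\<in>index_simplex a ` D. card (ridges F)) = (\<Sum>I\<in>D. card (ridges (index_simplex a I)))"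
    using injD by (simp add: sum.reindex)
  also have "\<dots> = (\<Sum>I\<in>D. CARD('n))"
    by (rule sum.cong) (auto simp: D_def LI ridges_index_simplex(2)[OF gp m])
  finally have "bb_step_cost a t (bb_facets a k) = card L + (1 + CARD('n)) * card D"
    unfolding bb_step_cost_def removed using inj injD by (simp add: F card_image)
  then show "bb_step_cost a (CARD('n) + k) (bb_facets a k) =
      card (algorithm_indices (facet_index a) CARD('n) k) + (1 + CARD('n)) *
      card {I \<in> algorithm_indices (facet_index a) CARD('n) k. \<not> facet_index a (Suc (CARD('n) + k)) I}"
    by (simp add: L_def D_def t_def)
qed simp

section \<open>Bound and measurability of the cost\<close>

lemma card_algorithm_indices_le:
  fixes a :: "nat \<Rightarrow> real ^ 'n"
  shows "card (algorithm_indices (facet_index a) n k) \<le> card {I. facet_index a (n + k) I}"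
  by (intro card_mono finite_facet_index algorithm_indices_subset)

lemma algorithm_cost_le:
  fixes a :: "nat \<Rightarrow> real ^ 'n"
  shows "algorithm_cost (facet_index a) n m \<le> (n + 2) * (\<Sum>k<m - n. card {I. facet_index a (n + k) I})"
  unfolding algorithm_cost_def sum_distrib_left
proof (rule sum_mono)
  fix k
  let ?L = "algorithm_indices (facet_index a) n k"
  have fin: "finite ?L" by (rule finite_subset[OF algorithm_indices_subset finite_facet_index])
  have "card {I \<in> ?L. \<not> facet_index a (Suc (n + k)) I} \<le> card ?L"
    by (rule card_mono[OF fin]) auto
  then have "card ?L + (1 + n) * card {I \<in> ?L. \<not> facet_index a (Suc (n + k)) I} \<le> card ?L + (1 + n) * card ?L"
    by (intro add_mono mult_le_mono order.refl)
  also have "\<dots> = (n + 2) * card ?L" by simp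
  also have "\<dots> \<le> (n + 2) * card {I. facet_index a (n + k) I}"
    by (intro mult_le_mono order.refl card_algorithm_indices_le)
  finally show "card ?L + (1 + n) * card {I \<in> ?L. \<not> facet_index a (Suc (n + k)) I}
      \<le> (n + 2) * card {I. facet_index a (n + k) I}" .
qed

text \<open>Membership at the next time is a Boolean combination of earlier memberships and sign
  tests. Restricting the existential over index sets to subsets of \<open>{0..n + k}\<close> makes
  the combination finite.\<close>

lemma pred_algorithm_indices:
  assumes "n + k \<le> m"
  shows "Measurable.pred (sphere_product m)
    (\<lambda>a :: nat \<Rightarrow> real ^ 'n. I \<in> algorithm_indices (facet_index a) n k)"
  using assms
proof (induction k arbitrary: I)
  case 0
  then show ?case using measurable_facet_index[of n m I, where 'n = 'n] by simp
next
  case (Suc k)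
  let ?T = "Pow {0..n + k}"
  have [measurable]: "Measurable.pred (sphere_product m) (\<lambda>a :: nat \<Rightarrow> real ^ 'n. J \<in> algorithm_indices (facet_index a) n k)" for J
    using Suc by simp
  have [measurable]: "Measurable.pred (sphere_product m) (\<lambda>a :: nat \<Rightarrow> real ^ 'n. facet_index a (Suc (n + k)) J)" for J
    using Suc.prems by (intro measurable_facet_index) simp
  have sub: "algorithm_indices (facet_index a) n k \<subseteq> ?T" for a :: "nat \<Rightarrow> real ^ 'n"
    using algorithm_indices_subset[of "facet_index a" n k] by (auto simp: facet_index_def)
  have "I \<in> algorithm_indices (facet_index a) n (Suc k) \<longleftrightarrow>
      (I \<in> algorithm_indices (facet_index a) n k \<and> facet_index a (Suc (n + k)) I) \<or>
      (facet_index a (Suc (n + k)) I \<and> (\<exists>J\<in>?T. J \<in> algorithm_indices (facet_index a) n k \<and>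
         \<not> facet_index a (Suc (n + k)) J \<and> (\<exists>i\<in>J. I = insert (Suc (n + k)) (J - {i}))))"
    for a :: "nat \<Rightarrow> real ^ 'n"
    unfolding algorithm_indices.simps using sub[of a] by blast
  moreover have "Measurable.pred (sphere_product m) (\<lambda>a :: nat \<Rightarrow> real ^ 'n.
      (I \<in> algorithm_indices (facet_index a) n k \<and> facet_index a (Suc (n + k)) I) \<or>
      (facet_index a (Suc (n + k)) I \<and> (\<exists>J\<in>?T. J \<in> algorithm_indices (facet_index a) n k \<and>
         \<not> facet_index a (Suc (n + k)) J \<and> (\<exists>i\<in>J. I = insert (Suc (n + k)) (J - {i})))))"
  proof -
    have [measurable]: "Measurable.pred (sphere_product m) (\<lambda>a :: nat \<Rightarrow> real ^ 'n.
      (\<exists>J\<in>?T. J \<in> algorithm_indices (facet_index a) n k \<and>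
         \<not> facet_index a (Suc (n + k)) J \<and> (\<exists>i\<in>J. I = insert (Suc (n + k)) (J - {i}))))"
      by (rule pred_intros_finite(4), simp, measurable)
    show ?thesis by measurable
  qed
  ultimately show ?case by simp
qed

lemma borel_measurable_card_subset:
  assumes "finite T" "\<And>x. A x \<subseteq> T" "\<And>I. Measurable.pred M (\<lambda>x. I \<in> A x)"
  shows "(\<lambda>x. real (card (A x))) \<in> borel_measurable M"
proof -
  have "real (card (A x)) = (\<Sum>I\<in>T. if I \<in> A x then 1 else 0)" for x
    using assms(1,2) by (simp add: sum.If_cases Int_absorb1)
  moreover have "(\<lambda>x. \<Sum>I\<in>T. if I \<in> A x then 1 else 0 :: real) \<in> borel_measurable M"
    using assms(3) by measurable
  ultimately show ?thesis by simp
qed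

lemma borel_measurable_algorithm_cost:
  "(\<lambda>a :: nat \<Rightarrow> real ^ 'n. real (algorithm_cost (facet_index a) n m)) \<in> borel_measurable (sphere_product m)"
proof -
  have sub: "algorithm_indices (facet_index a) n k \<subseteq> Pow {0..n + k}" for a :: "nat \<Rightarrow> real ^ 'n" and k
    using algorithm_indices_subset[of "facet_index a" n k] by (auto simp: facet_index_def)
  have "(\<lambda>a :: nat \<Rightarrow> real ^ 'n. real (card (algorithm_indices (facet_index a) n k))) \<in> borel_measurable (sphere_product m)"
    "(\<lambda>a :: nat \<Rightarrow> real ^ 'n. real (card {I \<in> algorithm_indices (facet_index a) n k. \<not> facet_index a (Suc (n + k)) I}))
      \<in> borel_measurable (sphere_product m)" if "k \<in> {..<m - n}" for k
  proof -
    have k: "n + k \<le> m" "Suc (n + k) \<le> m" using that by auto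
    note [measurable] = pred_algorithm_indices[OF k(1)] measurable_facet_index[OF k(2)]
    show "(\<lambda>a :: nat \<Rightarrow> real ^ 'n. real (card (algorithm_indices (facet_index a) n k))) \<in> borel_measurable (sphere_product m)"
      by (rule borel_measurable_card_subset[OF _ sub]) measurable
    show "(\<lambda>a :: nat \<Rightarrow> real ^ 'n. real (card {I \<in> algorithm_indices (facet_index a) n k. \<not> facet_index a (Suc (n + k)) I}))
      \<in> borel_measurable (sphere_product m)"
    proof (rule borel_measurable_card_subset[of "Pow {0..n + k}"])
      show "{I \<in> algorithm_indices (facet_index a) n k. \<not> facet_index a (Suc (n + k)) I} \<subseteq> Pow {0..n + k}"
        for a :: "nat \<Rightarrow> real ^ 'n" using sub[of a k] by blast
    next
      fix I
      show "Measurable.pred (sphere_product m) (\<lambda>a :: nat \<Rightarrow> real ^ 'n.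
          I \<in> {I \<in> algorithm_indices (facet_index a) n k. \<not> facet_index a (Suc (n + k)) I})"
        unfolding mem_Collect_eq by measurable
    qed simp
  qed
  then show ?thesis
    unfolding algorithm_cost_def of_nat_sum of_nat_add of_nat_mult
    by (intro borel_measurable_sum borel_measurable_add borel_measurable_times borel_measurable_const) auto
qed

subsection \<open>The probability that an index set spans a facet\<close>

text \<open>Allows \<open>side\<close> to be frozen once the points of \<open>I\<close> are fixed
  while the remaining points are still random.\<close>

lemma side_cong:
  assumes I: "card I = CARD('n)" and ab: "\<And>i. i \<in> I \<Longrightarrow> pt a i = (pt b i :: real ^ 'n)"
  shows "side a I x = side b I x"
proof -
  obtain e :: "'n \<Rightarrow> nat" where e: "bij_betw e UNIV I"
    "\<And>(a :: nat \<Rightarrow> real ^ 'n) x.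
       side a I x = simplex_det (\<lambda>i. case i of None \<Rightarrow> x | Some k \<Rightarrow> pt a (e k))"
    using side_enum[OF I] by blast
  have "pt a (e k) = pt b (e k)" for k using ab bij_betw_apply[OF e(1)] by blast
  then show ?thesis by (simp only: e(2))
qed

text \<open>The halfspace misses the opposite cap around \<open>- (u /\<^sub>R norm u)\<close>. With
  \<open>w \<ge> 0\<close> the height \<open>w / norm u\<close> of this cap is nonnegative, as the
  lower bound for caps requires.\<close>

lemma measure_uniform_sphere_halfspace_le:
  fixes u :: "real ^ 'n"
  assumes w: "w \<ge> 0" "w < norm u" and s: "0 \<le> s" "s \<le> sqrt (1 - (w / norm u)\<^sup>2)"
  shows "measure uniform_sphere {y. u \<bullet> y + w > 0} \<le> 1 - s ^ (CARD('n) - 1) / (2 * 4 ^ CARD('n))"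
proof -
  interpret prob_space "uniform_sphere :: (real ^ 'n) measure" by (rule prob_space_uniform_sphere)
  define v where "v = - (u /\<^sub>R norm u)"
  have u: "norm u > 0" using w by linarith
  have v: "norm v = 1" using u by (simp add: v_def)
  let ?cap = "{y. v \<bullet> y > w / norm u}" and ?half = "{y. u \<bullet> y + w > 0}"
  have "s ^ (CARD('n) - 1) / (2 * 4 ^ CARD('n)) \<le> sqrt (1 - (w / norm u)\<^sup>2) ^ (CARD('n) - 1) / (2 * 4 ^ CARD('n))"
    using s by (intro divide_right_mono power_mono) auto
  also have "\<dots> \<le> prob ?cap"
    using w u by (intro measure_uniform_sphere_cap_ge v) auto
  finally have cap: "s ^ (CARD('n) - 1) / (2 * 4 ^ CARD('n)) \<le> prob ?cap" .
  have "?half \<inter> ?cap = {}"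
  proof (intro equals0I, elim IntE)
    fix y assume "y \<in> ?half" "y \<in> ?cap"
    then have "u \<bullet> y + w > 0" "- (u \<bullet> y) / norm u > w / norm u"
      by (auto simp: v_def divide_inverse mult.commute)
    then have "w / norm u * norm u < - (u \<bullet> y) / norm u * norm u"
      by (intro mult_strict_right_mono u)
    then show False using \<open>u \<bullet> y + w > 0\<close> u by simp
  qed
  moreover have "?half \<in> events" "?cap \<in> events" by simp_all
  ultimately have "prob ?half + prob ?cap = prob (?half \<union> ?cap)"
    by (intro finite_measure_Union[symmetric])
  also have "\<dots> \<le> 1" by simp
  finally show ?thesis using cap by linarith
qed

lemma prob_PiM_uniform_sphere_le:
  fixes J T :: "nat set"
  assumes J: "finite J" "T \<subseteq> J" and H: "H \<in> sets borel" "measure (uniform_sphere :: (real ^ 'n) measure) H \<le> p"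
  shows "emeasure (\<Pi>\<^sub>M i\<in>J. uniform_sphere)
    {y \<in> space (\<Pi>\<^sub>M i\<in>J. (uniform_sphere :: (real ^ 'n) measure)). \<forall>j\<in>T. y j \<in> H} \<le> ennreal (p ^ card T)"
proof -
  interpret U: prob_space "uniform_sphere :: (real ^ 'n) measure" by (rule prob_space_uniform_sphere)
  interpret product_sigma_finite "\<lambda>_ :: nat. uniform_sphere :: (real ^ 'n) measure"
    by (rule product_sigma_finite_uniform_sphere)
  let ?A = "\<lambda>j. if j \<in> T then H else UNIV"
  have "{y \<in> space (\<Pi>\<^sub>M i\<in>J. (uniform_sphere :: (real ^ 'n) measure)). \<forall>j\<in>T. y j \<in> H} = Pi\<^sub>E J ?A"
    using J by (auto simp: space_PiM PiE_iff extensional_def split: if_splits)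
  also have "emeasure (\<Pi>\<^sub>M i\<in>J. uniform_sphere) (Pi\<^sub>E J ?A) = (\<Prod>j\<in>J. emeasure (uniform_sphere :: (real ^ 'n) measure) (?A j))"
    using H by (intro emeasure_PiM J(1)) auto
  also have "\<dots> = (\<Prod>j\<in>J. if j \<in> T then ennreal (U.prob H) else 1)"
    using U.emeasure_space_1 by (intro prod.cong) (auto simp: U.emeasure_eq_measure)
  also have "\<dots> = ennreal (U.prob H) ^ card T"
    using J by (simp add: prod.If_cases Int_absorb1)
  also have "\<dots> = ennreal (U.prob H ^ card T)" by (simp add: ennreal_power)
  also have "\<dots> \<le> ennreal (p ^ card T)" using H by (intro ennreal_leI power_mono) auto
  finally show ?thesis .
qed

lemma sets_near:
  fixes I :: "nat set"
  assumes I: "finite I" "i \<in> I"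
  shows "{x \<in> space (\<Pi>\<^sub>M i\<in>I. (uniform_sphere :: (real ^ 'n) measure)). \<forall>j\<in>I - {i}. x j \<in> cball (x i) r}
    \<in> sets (\<Pi>\<^sub>M i\<in>I. (uniform_sphere :: (real ^ 'n) measure))"
proof -
  have [measurable]: "(\<lambda>x. x j) \<in> borel_measurable (\<Pi>\<^sub>M i\<in>I. (uniform_sphere :: (real ^ 'n) measure))"
    if "j \<in> I" for j
    using that by (rule measurable_sphere_product_component)
  have "Measurable.pred (\<Pi>\<^sub>M i\<in>I. (uniform_sphere :: (real ^ 'n) measure)) (\<lambda>x. \<forall>j\<in>I - {i}. x j \<in> cball (x i) r)"
    unfolding mem_cball using I by measurable
  then show ?thesis by (simp add: pred_def)
qed

text \<open>Given the point with index \<open>i\<close>, the others must fall independently into a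
  fixed ball of radius \<open>2 * s\<close>; its bound
  \<open>2 ^ (n + 1) * (2 * s) ^ (n - 1)\<close> simplifies to the stated base.\<close>

lemma prob_near_le:
  fixes I :: "nat set"
  assumes I: "finite I" "i \<in> I" and s: "s > 0"
  shows "emeasure (\<Pi>\<^sub>M i\<in>I. uniform_sphere)
    {x \<in> space (\<Pi>\<^sub>M i\<in>I. (uniform_sphere :: (real ^ 'n) measure)). \<forall>j\<in>I - {i}. x j \<in> cball (x i) (2 * s)}
    \<le> ennreal ((4 ^ CARD('n) * s ^ (CARD('n) - 1)) ^ (card I - 1))"
proof -
  interpret U: prob_space "uniform_sphere :: (real ^ 'n) measure" by (rule prob_space_uniform_sphere)
  interpret product_sigma_finite "\<lambda>_ :: nat. uniform_sphere :: (real ^ 'n) measure"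
    by (rule product_sigma_finite_uniform_sphere)
  let ?U = "uniform_sphere :: (real ^ 'n) measure"
  let ?q = "4 ^ CARD('n) * s ^ (CARD('n) - 1)"
  define I' where "I' = I - {i}"
  have I': "insert i I' = I" "i \<notin> I'" "finite I'" "card I' = card I - 1" using I by (auto simp: I'_def)
  let ?P = "\<lambda>x. \<forall>j\<in>I'. x j \<in> cball (x i) (2 * s)"
  have near [measurable]: "{x \<in> space (\<Pi>\<^sub>M i\<in>insert i I'. ?U). ?P x} \<in> sets (\<Pi>\<^sub>M i\<in>insert i I'. ?U)"
    using sets_near[OF I, of "2 * s", where 'n = 'n] by (simp only: I'(1) I'_def[symmetric])
  have "emeasure (\<Pi>\<^sub>M i\<in>I. ?U) {x \<in> space (\<Pi>\<^sub>M i\<in>I. ?U). \<forall>j\<in>I - {i}. x j \<in> cball (x i) (2 * s)} =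
      (\<integral>\<^sup>+x. indicator {x \<in> space (\<Pi>\<^sub>M i\<in>insert i I'. ?U). ?P x} x \<partial>(\<Pi>\<^sub>M i\<in>insert i I'. ?U))"
    unfolding nn_integral_indicator[OF near] by (simp only: I'(1) I'_def[symmetric])
  also have "\<dots> = (\<integral>\<^sup>+y. (\<integral>\<^sup>+x. indicator {x \<in> space (\<Pi>\<^sub>M i\<in>insert i I'. ?U). ?P x} (x(i := y)) \<partial>(\<Pi>\<^sub>M i\<in>I'. ?U)) \<partial>?U)"
    by (rule product_nn_integral_insert_rev[OF I'(3,2)]) measurable
  also have "\<dots> \<le> (\<integral>\<^sup>+y. ennreal (?q ^ card I') \<partial>?U)"
  \<comment> \<open>The ball estimate needs a centre on the sphere, which is available only almost
    surely.\<close>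
  proof (rule nn_integral_mono_AE, use AE_uniform_sphere in eventually_elim)
    fix y :: "real ^ 'n" assume "y \<in> sphere 0 1"
    then have "measure ?U (cball y (2 * s)) \<le> 2 ^ (CARD('n) + 1) * (2 * s) ^ (CARD('n) - 1)"
      using s by (intro measure_uniform_sphere_cball_le) auto
    also have "\<dots> = ?q"
    proof -
      have "(2::real) ^ (CARD('n) + 1) * 2 ^ (CARD('n) - 1) = 2 ^ (CARD('n) + 1 + (CARD('n) - 1))"
        by (simp only: power_add)
      also have "CARD('n) + 1 + (CARD('n) - 1) = 2 * CARD('n)" using zero_less_card_finite[where 'a = 'n] by linarith
      also have "(2::real) ^ (2 * CARD('n)) = 4 ^ CARD('n)" by (simp add: power_mult)
      finally show ?thesis by (simp add: power_mult_distrib)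
    qed
    finally have m: "measure ?U (cball y (2 * s)) \<le> ?q" .
    have "(\<integral>\<^sup>+x. indicator {x \<in> space (\<Pi>\<^sub>M i\<in>insert i I'. ?U). ?P x} (x(i := y)) \<partial>(\<Pi>\<^sub>M i\<in>I'. ?U)) =
        (\<integral>\<^sup>+x. indicator {x \<in> space (\<Pi>\<^sub>M i\<in>I'. ?U). \<forall>j\<in>I'. x j \<in> cball y (2 * s)} x \<partial>(\<Pi>\<^sub>M i\<in>I'. ?U))"
      using I'(2) by (intro nn_integral_cong) (auto simp: indicator_def space_PiM PiE_iff extensional_def)
    also have "\<dots> = emeasure (\<Pi>\<^sub>M i\<in>I'. ?U) {x \<in> space (\<Pi>\<^sub>M i\<in>I'. ?U). \<forall>j\<in>I'. x j \<in> cball y (2 * s)}"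
    proof (rule nn_integral_indicator)
      have [measurable]: "(\<lambda>x. x j) \<in> borel_measurable (\<Pi>\<^sub>M i\<in>I'. ?U)" if "j \<in> I'" for j
        using that by (rule measurable_sphere_product_component)
      have "Measurable.pred (\<Pi>\<^sub>M i\<in>I'. ?U) (\<lambda>x. \<forall>j\<in>I'. x j \<in> cball y (2 * s))"
        unfolding mem_cball using I'(3) by measurable
      then show "{x \<in> space (\<Pi>\<^sub>M i\<in>I'. ?U). \<forall>j\<in>I'. x j \<in> cball y (2 * s)} \<in> sets (\<Pi>\<^sub>M i\<in>I'. ?U)"
        by (simp add: pred_def)
    qed
    also have "\<dots> \<le> ennreal (?q ^ card I')"
      by (rule prob_PiM_uniform_sphere_le[OF I'(3) order.refl _ m]) simp
    finally show "(\<integral>\<^sup>+x. indicator {x \<in> space (\<Pi>\<^sub>M i\<in>insert i I'. ?U). ?P x} (x(i := y)) \<partial>(\<Pi>\<^sub>M i\<in>I'. ?U))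
      \<le> ennreal (?q ^ card I')" .
  qed
  also have "\<dots> = ennreal (?q ^ (card I - 1))" using U.emeasure_space_1 by (simp add: I')
  finally show ?thesis .
qed

text \<open>All points of the section have the same distance
  \<open>sqrt (1 - (c / norm u)\<^sup>2)\<close> from the foot \<open>p\<close> of the perpendicular
  from the origin; the bound is the triangle inequality through \<open>p\<close>.\<close>

lemma dist_le_on_sphere_section:
  fixes u x y :: "'a :: real_inner"
  assumes u: "u \<noteq> 0" and x: "norm x = 1" "u \<bullet> x = c" and y: "norm y = 1" "u \<bullet> y = c"
  shows "dist x y \<le> 2 * sqrt (1 - (c / norm u)\<^sup>2)"
proof -
  define p where "p = (c / (norm u)\<^sup>2) *\<^sub>R u"
  have *: "norm (z - p) = sqrt (1 - (c / norm u)\<^sup>2)" if z: "norm z = 1" "u \<bullet> z = c" for z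
  proof -
    have "(norm (z - p))\<^sup>2 = (norm z)\<^sup>2 - 2 * (z \<bullet> p) + (norm p)\<^sup>2"
      by (simp add: power2_norm_eq_inner inner_diff_left inner_diff_right inner_commute)
    also have "z \<bullet> p = (c / norm u)\<^sup>2"
      using z by (simp add: p_def inner_commute power2_eq_square)
    also have "(norm p)\<^sup>2 = (c / norm u)\<^sup>2"
      using u by (simp add: p_def power2_eq_square)
    finally have "(norm (z - p))\<^sup>2 = 1 - (c / norm u)\<^sup>2" using z by simp
    then show ?thesis by (metis norm_ge_zero real_sqrt_unique)
  qed
  have "dist x y \<le> norm (x - p) + norm (y - p)"
    by (metis dist_norm dist_triangle2)
  then show ?thesis using * x y by simp
qed

text \<open>
  Given the points of \<open>I\<close>, all other points miss a cap bounded by their hyperplane. This cap is at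
  most a hemisphere, because the origin is not inside the half-space cutting it off. Unless the
  points of \<open>I\<close> are within distance \<open>2 * s\<close> of each other, it has measure at least \<open>V\<close>.
\<close>

lemma prob_facet_index_le:
  assumes s: "0 < s" "s \<le> 1"
    and I: "I \<subseteq> {0..t}" "card I = CARD('n)" and t: "t \<le> m"
  defines "V \<equiv> s ^ (CARD('n) - 1) / (2 * 4 ^ CARD('n))"
  shows "emeasure (sphere_product m) {a \<in> space (sphere_product m). facet_index (a :: nat \<Rightarrow> real ^ 'n) t I}
    \<le> ennreal ((if 0 \<in> I then 0 else (4 ^ CARD('n) * s ^ (CARD('n) - 1)) ^ (CARD('n) - 1))
        + 2 * (1 - V) ^ (t - CARD('n)))"
proof -
  interpret U: prob_space "uniform_sphere :: (real ^ 'n) measure" by (rule prob_space_uniform_sphere)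
  let ?U = "uniform_sphere :: (real ^ 'n) measure"
  let ?M = "\<lambda>J. \<Pi>\<^sub>M i\<in>J. ?U"
  have prob_M: "emeasure (?M J) (space (?M J)) = 1" for J :: "nat set"
    by (intro prob_space.emeasure_space_1 prob_space_PiM prob_space_uniform_sphere)
  \<comment> \<open>The sample is split into the points of \<open>I\<close> and the rest; the origin
    is not random, so index 0 is left out of \<open>J\<close>. Among the rest, \<open>T\<close>
    collects the points present at time \<open>t\<close>, at least \<open>t - n\<close> of
    them.\<close>
  define J where "J = I - {0}"
  define J' where "J' = {1..m} - J"
  define T where "T = {1..t} - J"
  define q where "q = (1 - V) ^ (t - CARD('n))"
  have "finite I" using I by (auto intro: finite_subset)
  have J: "J \<inter> J' = {}" "finite J" "finite J'" "J \<union> J' = {1..m}" "T \<subseteq> J'"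
    using I t \<open>finite I\<close> by (auto simp: J_def J'_def T_def)
  have "card I \<noteq> 0" unfolding I by simp
  then obtain i0 where i0: "i0 \<in> I" by fastforce
  have "1 \<le> 2 * (4::real) ^ CARD('n)" using one_le_power[of "4::real" "CARD('n)"] by linarith
  then have "s ^ (CARD('n) - 1) / (2 * 4 ^ CARD('n)) \<le> 1 / 1"
    using s by (intro frac_le power_le_one) auto
  then have V: "0 \<le> V" "V \<le> 1" using s by (auto simp: V_def)
  have q: "0 \<le> q" using V by (simp add: q_def)
  \<comment> \<open>The exceptional event that the points are close together. For facets through the
    origin the empty cap is a hemisphere, whatever the spread of the points, so the event is
    empty.\<close>
  define A where "A = (if 0 \<in> I then {} else
      {x \<in> space (?M I). \<forall>j\<in>I - {i0}. x j \<in> cball (x i0) (2 * s)})"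
  have J_eq: "J = I" if "0 \<notin> I" using that by (simp add: J_def)
  have A [measurable]: "A \<in> sets (?M J)"
    using sets_near[OF \<open>finite I\<close> i0, where 'n = 'n] J_eq by (simp add: A_def)
  have cT: "t - CARD('n) \<le> card T"
  proof -
    have "card J \<le> CARD('n)" using I \<open>finite I\<close> by (metis J_def card_Diff1_le)
    moreover have "card {1..t} - card J \<le> card T" unfolding T_def by (rule diff_card_le_card_Diff[OF J(2)])
    ultimately show ?thesis by simp
  qed
  have half: "emeasure (?M J') {y \<in> space (?M J'). \<forall>j\<in>T. y j \<in> {z. v \<bullet> z + c > 0}} \<le> ennreal q"
    if x: "x \<in> space (?M J)" "x \<notin> A" "\<And>j. j \<in> J \<Longrightarrow> norm (x j) = 1"
      and vc: "\<And>i. i \<in> I \<Longrightarrow> v \<bullet> pt x i + c = 0" "c \<ge> 0" for x v c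
  proof -
    have "measure ?U {z. v \<bullet> z + c > 0} \<le> 1 - V"
    proof (cases "v = 0")
      case True
      then show ?thesis using vc(1)[OF i0] V by simp
    next
      case False
      have "c < norm v \<and> s \<le> sqrt (1 - (c / norm v)\<^sup>2)"
      proof (cases "0 \<in> I")
        case True
        then have "c = 0" using vc(1)[of 0] by (simp add: pt_def)
        then show ?thesis using False s by simp
      next
        case F: False
        then have pt: "pt x i = x i" if "i \<in> I" for i using that by (auto simp: pt_def)
        obtain j where j: "j \<in> I" "dist (x i0) (x j) > 2 * s"
          using x(1,2) F J_eq[OF F] by (auto simp: A_def not_le)
        \<comment> \<open>Two points more than \<open>2 * s\<close> apart on the hyperplane force
          the boundary radius of the cap above \<open>s\<close>, which also yields
          \<open>c < norm v\<close>.\<close>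
        have "dist (x i0) (x j) \<le> 2 * sqrt (1 - (- c / norm v)\<^sup>2)"
        proof (rule dist_le_on_sphere_section[OF False])
          show "norm (x i0) = 1" "norm (x j) = 1" using x(3) j i0 J_eq[OF F] by auto
          show "v \<bullet> x i0 = - c" "v \<bullet> x j = - c"
            using vc(1)[OF i0] vc(1)[OF j(1)] pt[OF i0] pt[OF j(1)] by auto
        qed
        then have *: "s < sqrt (1 - (c / norm v)\<^sup>2)" using j by simp
        then have "(c / norm v)\<^sup>2 < 1" using s by (smt (verit) real_sqrt_le_0_iff)
        then have "\<bar>c / norm v\<bar> < 1" by (simp only: abs_square_less_1)
        then have "c / norm v < 1" by linarith
        then show ?thesis using * False by simp
      qed
      then show ?thesis
        unfolding V_def using vc(2) s by (intro measure_uniform_sphere_halfspace_le) auto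
    qed
    then have "emeasure (?M J') {y \<in> space (?M J'). \<forall>j\<in>T. y j \<in> {z. v \<bullet> z + c > 0}} \<le> ennreal ((1 - V) ^ card T)"
      by (intro prob_PiM_uniform_sphere_le J) auto
    also have "\<dots> \<le> ennreal q"
      unfolding q_def using V cT by (intro ennreal_leI power_decreasing) auto
    finally show ?thesis .
  qed
  define E where "E = {a \<in> space (sphere_product m). facet_index (a :: nat \<Rightarrow> real ^ 'n) t I}"
  have E: "E \<in> sets (?M (J \<union> J'))"
    using measurable_facet_index[OF t, of I] unfolding E_def J(4) pred_def by simp
  have inner: "(\<integral>\<^sup>+y. indicator E (merge J J' (x, y)) \<partial>?M J') \<le> indicator A x + ennreal (2 * q)"
    if x: "x \<in> space (?M J)" "\<And>j. j \<in> J \<Longrightarrow> norm (x j) = 1" for x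
  proof (cases "x \<in> A")
    case True
    have "(\<integral>\<^sup>+y. indicator E (merge J J' (x, y)) \<partial>?M J') \<le> (\<integral>\<^sup>+y. 1 \<partial>?M J')"
      by (intro nn_integral_mono) (simp add: indicator_def)
    also have "\<dots> = 1" using prob_M by simp
    also have "\<dots> \<le> indicator A x + ennreal (2 * q)" using True by simp
    finally show ?thesis .
  next
    case False
    obtain u w where uw: "\<And>z. side x I z = u \<bullet> z + w" "\<And>i. i \<in> I \<Longrightarrow> u \<bullet> pt x i + w = 0"
      using side_affine[OF I(2)] by blast
    define P where "P v c = {y \<in> space (?M J'). \<forall>j\<in>T. y j \<in> {z. v \<bullet> z + c > 0}}" for v :: "real ^ 'n" and c :: real
    have [measurable]: "P v c \<in> sets (?M J')" for v c
    proof -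
      have [measurable]: "(\<lambda>y. y j) \<in> borel_measurable (?M J')" if "j \<in> T" for j
        using that J(5) by (intro measurable_sphere_product_component) auto
      have "finite T" by (simp add: T_def)
      then have "Measurable.pred (?M J') (\<lambda>y. \<forall>j\<in>T. y j \<in> {z. v \<bullet> z + c > 0})"
        unfolding mem_Collect_eq by measurable
      then show ?thesis by (simp add: P_def pred_def)
    qed
    \<comment> \<open>The value of \<open>side\<close> at the origin is \<open>w\<close>, and the
      origin is among the tested points unless it belongs to \<open>I\<close>. So the sign of
      \<open>w\<close> decides which alternative of \<open>facet_index\<close> can occur; for
      \<open>w = 0\<close> both are kept, whence the factor 2 in front of \<open>q\<close>.\<close>
    define Q where "Q = (if w \<ge> 0 then P u w else {}) \<union> (if w \<le> 0 then P (- u) (- w) else {})"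
    have EQ: "y \<in> Q" if y: "y \<in> space (?M J')" "merge J J' (x, y) \<in> E" for y
    proof -
      let ?a = "merge J J' (x, y)"
      have side: "side ?a I z = u \<bullet> z + w" for z
        unfolding uw(1)[symmetric] by (rule side_cong[OF I(2)]) (auto simp: pt_def J_def merge_def)
      have ptT: "pt ?a j = y j" if "j \<in> T" for j
        using that t by (auto simp: pt_def T_def merge_def J'_def)
      have TI: "T \<subseteq> {0..t} - I" by (auto simp: T_def J_def)
      from y consider "\<forall>j\<in>{0..t} - I. side ?a I (pt ?a j) > 0" | "\<forall>j\<in>{0..t} - I. side ?a I (pt ?a j) < 0"
        by (auto simp: E_def facet_index_def)
      then show ?thesis
      proof cases
        case 1
        have "w \<ge> 0"
        proof (cases "0 \<in> I")
          case True
          then show ?thesis using uw(2)[of 0] by (simp add: pt_def)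
        next
          case False
          then show ?thesis using bspec[OF 1, of 0] by (simp add: side pt_def)
        qed
        moreover have "y \<in> P u w"
          unfolding P_def
        proof (intro CollectI conjI ballI y(1))
          fix j assume "j \<in> T"
          then show "u \<bullet> y j + w > 0" using bspec[OF 1, of j] TI ptT[of j] by (auto simp: side)
        qed
        ultimately show ?thesis by (simp add: Q_def)
      next
        case 2
        have "w \<le> 0"
        proof (cases "0 \<in> I")
          case True
          then show ?thesis using uw(2)[of 0] by (simp add: pt_def)
        next
          case False
          then show ?thesis using bspec[OF 2, of 0] by (simp add: side pt_def)
        qed
        moreover have "y \<in> P (- u) (- w)"
          unfolding P_def
        proof (intro CollectI conjI ballI y(1))
          fix j assume "j \<in> T"
          then show "- u \<bullet> y j + - w > 0" using bspec[OF 2, of j] TI ptT[of j] by (auto simp: side)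
        qed
        ultimately show ?thesis by (simp add: Q_def)
      qed
    qed
    have "(\<integral>\<^sup>+y. indicator E (merge J J' (x, y)) \<partial>?M J') \<le> (\<integral>\<^sup>+y. indicator Q y \<partial>?M J')"
      using EQ by (intro nn_integral_mono) (auto simp: indicator_def)
    also have "\<dots> = emeasure (?M J') Q" unfolding Q_def by (intro nn_integral_indicator) auto
    also have "\<dots> \<le> emeasure (?M J') (if w \<ge> 0 then P u w else {})
        + emeasure (?M J') (if w \<le> 0 then P (- u) (- w) else {})"
      unfolding Q_def by (intro emeasure_subadditive) auto
    also have "\<dots> \<le> ennreal q + ennreal q"
    proof (intro add_mono)
      show "emeasure (?M J') (if w \<ge> 0 then P u w else {}) \<le> ennreal q"
        using half[OF x(1) False x(2), of u w] uw(2) by (simp add: P_def)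
      show "emeasure (?M J') (if w \<le> 0 then P (- u) (- w) else {}) \<le> ennreal q"
      proof (cases "w \<le> 0")
        case True
        have "- u \<bullet> pt x i + - w = 0" if "i \<in> I" for i using uw(2)[OF that] by simp
        then show ?thesis using half[OF x(1) False x(2), of "- u" "- w"] True by (simp only: P_def if_True neg_0_le_iff_le)
      qed simp
    qed
    also have "\<dots> = ennreal (2 * q)" using q by (simp flip: ennreal_plus)
    finally show ?thesis using False by simp
  qed
  interpret product_sigma_finite "\<lambda>_ :: nat. ?U" by (rule product_sigma_finite_uniform_sphere)
  have "AE x in ?M J. \<forall>j\<in>J. norm (x j) = 1"
  proof (intro AE_finite_allI J)
    fix j assume "j \<in> J"
    then show "AE x in ?M J. norm (x j) = 1"
      using AE_uniform_sphere prob_space_uniform_sphere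
      by (intro AE_PiM_component[where P = "\<lambda>z. norm z = 1"]) auto
  qed
  moreover have "AE x in ?M J. x \<in> space (?M J)" by (rule AE_space)
  ultimately have AE: "AE x in ?M J. (\<integral>\<^sup>+y. indicator E (merge J J' (x, y)) \<partial>?M J')
      \<le> indicator A x + ennreal (2 * q)"
    by eventually_elim (use inner in blast)
  have "emeasure (sphere_product m) E = (\<integral>\<^sup>+a. indicator E a \<partial>?M (J \<union> J'))"
    using E by (simp only: nn_integral_indicator J(4))
  also have "\<dots> = (\<integral>\<^sup>+x. (\<integral>\<^sup>+y. indicator E (merge J J' (x, y)) \<partial>?M J') \<partial>?M J)"
    using E by (intro product_nn_integral_fold J(1-3)) simp
  also have "\<dots> \<le> (\<integral>\<^sup>+x. indicator A x + ennreal (2 * q) \<partial>?M J)"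
    by (rule nn_integral_mono_AE[OF AE])
  also have "\<dots> = emeasure (?M J) A + ennreal (2 * q)"
    using prob_M by (simp add: nn_integral_add)
  also have "\<dots> \<le> ennreal (if 0 \<in> I then 0 else (4 ^ CARD('n) * s ^ (CARD('n) - 1)) ^ (CARD('n) - 1)) + ennreal (2 * q)"
    using prob_near_le[OF \<open>finite I\<close> i0 s(1), where 'n = 'n] J_eq I(2)
    by (intro add_right_mono) (auto simp: A_def)
  also have "\<dots> = ennreal ((if 0 \<in> I then 0 else (4 ^ CARD('n) * s ^ (CARD('n) - 1)) ^ (CARD('n) - 1)) + 2 * q)"
    using s q by (intro ennreal_plus[symmetric]) auto
  finally show ?thesis by (simp only: E_def q_def)
qed

subsection \<open>The expected complexity\<close>

text \<open>Linearity of expectation over index sets. Those avoiding 0, at most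
  \<open>t ^ n\<close>, carry the term for close points; all sets, at most
  \<open>(t + 1) ^ n\<close>, carry the term for an empty cap. The deterministic bound serves times
  \<open>t\<close> too small for an admissible radius.\<close>

lemma expected_facets_le:
  assumes t: "CARD('n) \<le> t" "t \<le> m"
  defines "F \<equiv> \<lambda>a :: nat \<Rightarrow> real ^ 'n. real (card {I. facet_index a t I})"
  shows "integrable (sphere_product m) F"
    and "\<And>a. F a \<le> (real t + 1) ^ CARD('n)"
    and "\<And>s. 0 < s \<Longrightarrow> s \<le> 1 \<Longrightarrow> (\<integral>a. F a \<partial>sphere_product m) \<le>
      real t ^ CARD('n) * (4 ^ CARD('n) * s ^ (CARD('n) - 1)) ^ (CARD('n) - 1) +
      (real t + 1) ^ CARD('n) * (2 * (1 - s ^ (CARD('n) - 1) / (2 * 4 ^ CARD('n))) ^ (t - CARD('n)))"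
proof -
  let ?M = "sphere_product m :: (nat \<Rightarrow> real ^ 'n) measure"
  interpret prob_space ?M by (intro prob_space_PiM prob_space_uniform_sphere)
  define S where "S = {I. I \<subseteq> {0..t} \<and> card I = CARD('n)}"
  define E where "E I = {a \<in> space ?M. facet_index a t I}" for I
  have finS: "finite S" by (rule finite_subset[of _ "Pow {0..t}"]) (auto simp: S_def)
  have sub: "{I. facet_index a t I} \<subseteq> S" for a :: "nat \<Rightarrow> real ^ 'n"
    by (auto simp: S_def facet_index_def)
  have E: "E I \<in> events" for I
    using measurable_facet_index[OF t(2), of I, where 'n = 'n] unfolding E_def pred_def by simp
  have F: "F a = (\<Sum>I\<in>S. indicator (E I) a)" if "a \<in> space ?M" for a
  proof -
    have "(\<Sum>I\<in>S. indicator (E I) a :: real) = (\<Sum>I\<in>S. if I \<in> {I. facet_index a t I} then 1 else 0)"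
      using that by (intro sum.cong) (auto simp: E_def)
    also have "\<dots> = real (card {I. facet_index a t I})"
      using finS sub[of a] by (simp only: sum.inter_restrict[symmetric] Int_absorb1) simp
    finally show ?thesis by (simp add: F_def)
  qed
  have intE: "integrable ?M (indicator (E I) :: _ \<Rightarrow> real)" for I
    by (intro integrable_real_indicator E)
      (simp only: emeasure_eq_measure infinity_ennreal_def ennreal_less_top)
  have int: "integrable ?M (\<lambda>a. \<Sum>I\<in>S. indicator (E I) a :: real)"
    by (intro Bochner_Integration.integrable_sum intE)
  show "integrable ?M F"
    using int by (rule Bochner_Integration.integrable_cong[THEN iffD2, rotated 2]) (simp_all add: F)
  have "card S = (t + 1) choose CARD('n)"
    using n_subsets[of "{0..t}" "CARD('n)"] by (simp add: S_def)
  also have "\<dots> \<le> (t + 1) ^ CARD('n)" using t by (intro binomial_le_pow) simp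
  finally have "real (card S) \<le> real ((t + 1) ^ CARD('n))" by (rule of_nat_mono)
  then have cS: "real (card S) \<le> (real t + 1) ^ CARD('n)" by (simp add: add.commute)
  show "F a \<le> (real t + 1) ^ CARD('n)" for a
  proof -
    have "F a \<le> real (card S)" unfolding F_def by (intro of_nat_mono card_mono finS sub)
    then show ?thesis using cS by linarith
  qed
  define S1 where "S1 = {I. I \<subseteq> {1..t} \<and> card I = CARD('n)}"
  have "card S1 = t choose CARD('n)" using n_subsets[of "{1..t}" "CARD('n)"] by (simp add: S1_def)
  also have "\<dots> \<le> t ^ CARD('n)" using t by (intro binomial_le_pow) simp
  finally have "real (card S1) \<le> real (t ^ CARD('n))" by (rule of_nat_mono)
  then have cS1: "real (card S1) \<le> real t ^ CARD('n)" by simp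
  have "{0..t} - {0} = {1..t}" by auto
  then have S1: "{I \<in> S. 0 \<notin> I} = S1" unfolding S_def S1_def by blast
  fix s :: real assume s: "0 < s" "s \<le> 1"
  define X where "X = (4 ^ CARD('n) * s ^ (CARD('n) - 1)) ^ (CARD('n) - 1)"
  define q where "q = (1 - s ^ (CARD('n) - 1) / (2 * 4 ^ CARD('n))) ^ (t - CARD('n))"
  have "1 \<le> 2 * (4::real) ^ CARD('n)" using one_le_power[of "4::real" "CARD('n)"] by linarith
  then have "s ^ (CARD('n) - 1) / (2 * 4 ^ CARD('n)) \<le> 1 / 1"
    using s by (intro frac_le power_le_one) auto
  then have Xq: "X \<ge> 0" "q \<ge> 0" using s by (auto simp: X_def q_def)
  have prob_E: "prob (E I) \<le> (if 0 \<notin> I then X else 0) + 2 * q" if "I \<in> S" for I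
  proof -
    have "emeasure ?M (E I) \<le> ennreal ((if 0 \<in> I then 0 else X) + 2 * q)"
      unfolding E_def X_def q_def using that by (intro prob_facet_index_le s t) (auto simp: S_def)
    moreover have "0 \<le> (if 0 \<in> I then 0 else X) + 2 * q" using Xq by simp
    ultimately have "prob (E I) \<le> (if 0 \<in> I then 0 else X) + 2 * q"
      by (simp only: emeasure_eq_measure ennreal_le_iff)
    then show ?thesis by (cases "0 \<in> I") simp_all
  qed
  have "(\<integral>a. F a \<partial>?M) = (\<integral>a. (\<Sum>I\<in>S. indicator (E I) a) \<partial>?M)"
    by (rule Bochner_Integration.integral_cong) (simp_all add: F)
  also have "\<dots> = (\<Sum>I\<in>S. \<integral>a. indicator (E I) a \<partial>?M)"
    by (rule Bochner_Integration.integral_sum[OF intE])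
  also have "\<dots> = (\<Sum>I\<in>S. prob (E I))"
  proof (intro sum.cong refl)
    fix I
    have "E I \<inter> space ?M = E I" unfolding E_def by blast
    then show "(\<integral>a. indicator (E I) a \<partial>?M) = prob (E I)"
      by (simp only: Bochner_Integration.integral_indicator)
  qed
  also have "\<dots> \<le> (\<Sum>I\<in>S. (if 0 \<notin> I then X else 0) + 2 * q)"
    by (intro sum_mono) (rule prob_E)
  also have "\<dots> = real (card S1) * X + real (card S) * (2 * q)"
    using finS by (simp add: sum.distrib sum.inter_filter[symmetric] S1)
  also have "\<dots> \<le> real t ^ CARD('n) * X + (real t + 1) ^ CARD('n) * (2 * q)"
    using cS cS1 Xq by (intro add_mono mult_right_mono) auto
  finally show "(\<integral>a. F a \<partial>?M) \<le> real t ^ CARD('n) * (4 ^ CARD('n) * s ^ (CARD('n) - 1)) ^ (CARD('n) - 1) +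
      (real t + 1) ^ CARD('n) * (2 * (1 - s ^ (CARD('n) - 1) / (2 * 4 ^ CARD('n))) ^ (t - CARD('n)))"
    by (simp add: X_def q_def)
qed

text \<open>The radius is chosen with \<open>s ^ (n - 1)\<close> proportional to
  \<open>ln m / t\<close>, which requires \<open>t\<close> above a multiple of \<open>ln m\<close>.
  At earlier times the crude bound suffices, since \<open>t ^ (n - 1)\<close> is then at most a
  constant times \<open>(ln m) ^ (n - 1)\<close>.\<close>

lemma expected_facets_log_bound:
  assumes n: "CARD('n :: finite) \<ge> 2"
  obtains C :: real where "C \<ge> 0"
    "\<And>t m. CARD('n) \<le> t \<Longrightarrow> t < m \<Longrightarrow> ln (real m) \<ge> 1 \<Longrightarrow>
      (\<integral>a. real (card {I. facet_index (a :: nat \<Rightarrow> real ^ 'n) t I}) \<partial>sphere_product m)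
        \<le> C * real t * ln (real m) ^ (CARD('n) - 1) + 2"
proof -
  define N where "N = CARD('n)"
  have N: "N \<ge> 2" using n by (simp add: N_def)
  \<comment> \<open>The cap has measure at least \<open>v = B * L / (2 * 4 ^ N * t)\<close>; with
    \<open>t / 2\<close> further points the exponent \<open>v * t / 2\<close> is then exactly
    \<open>N * L\<close>, which fixes \<open>B\<close>.\<close>
  define B :: real where "B = 4 * 4 ^ N * real N"
  define C where "C = (4 ^ N * B) ^ (N - 1) + 2 ^ N * B ^ (N - 1)"
  have B4: "B \<ge> 4 * real N"
    using mult_right_mono[of 1 "(4::real) ^ N" "4 * real N"] by (simp add: B_def mult.assoc mult.left_commute)
  have B: "B \<ge> 2 * real N" "B > 0" using B4 N by auto
  have "C \<ge> 0" using B by (simp add: C_def)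
  moreover have "(\<integral>a. real (card {I. facet_index (a :: nat \<Rightarrow> real ^ 'n) t I}) \<partial>sphere_product m)
        \<le> C * real t * ln (real m) ^ (N - 1) + 2"
    if t: "N \<le> t" "t < m" and L: "ln (real m) \<ge> 1" for t m
  proof -
    define L where "L = ln (real m)"
    have L1: "L \<ge> 1" using L by (simp add: L_def)
    define \<mu> where "\<mu> = (\<integral>a. real (card {I. facet_index (a :: nat \<Rightarrow> real ^ 'n) t I}) \<partial>sphere_product m)"
    interpret prob_space "sphere_product m :: (nat \<Rightarrow> real ^ 'n) measure"
      by (intro prob_space_PiM prob_space_uniform_sphere)
    have t': "CARD('n) \<le> t" "t \<le> m" using t by (auto simp: N_def)
    note ef = expected_facets_le[OF t', folded \<mu>_def N_def]
    have t_pow: "real t ^ N = real t * real t ^ (N - 1)" using N by (cases N) auto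
    have "\<mu> \<le> C * real t * L ^ (N - 1) + 2"
    proof (cases "real t \<le> B * L")
      case True
      have "\<mu> \<le> (\<integral>a. (real t + 1) ^ N \<partial>(sphere_product m :: (nat \<Rightarrow> real ^ 'n) measure))"
        unfolding \<mu>_def by (rule integral_mono[OF ef(1) integrable_const ef(2)])
      also have "\<dots> = (real t + 1) ^ N" by (simp only: lebesgue_integral_const prob_space) simp
      also have "\<dots> \<le> (2 * real t) ^ N" using t N by (intro power_mono) auto
      also have "\<dots> = 2 ^ N * (real t * real t ^ (N - 1))" by (simp add: power_mult_distrib t_pow)
      also have "\<dots> \<le> 2 ^ N * (real t * (B * L) ^ (N - 1))"
        using True by (intro mult_left_mono power_mono) auto
      also have "\<dots> = (2 ^ N * B ^ (N - 1)) * (real t * L ^ (N - 1))" by (simp add: power_mult_distrib)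
      also have "\<dots> \<le> C * (real t * L ^ (N - 1))"
        using B L1 by (intro mult_right_mono) (auto simp: C_def)
      finally show ?thesis by simp
    next
      case False
      \<comment> \<open>so that the caps are large enough to leave a failure probability of at most \<open>m ^ (- N)\<close>\<close>
      define z where "z = B * L / real t"
      have t0: "real t > 0" using t N by simp
      have z: "0 < z" "z \<le> 1" using False B L1 t0 by (auto simp: z_def)
      define s where "s = root (N - 1) z"
      have s: "0 < s" "s \<le> 1" "s ^ (N - 1) = z"
        using z N by (auto simp: s_def real_root_pow_pos2)
      have "real t ^ N * (4 ^ N * z) ^ (N - 1) = real t * (real t * (4 ^ N * z)) ^ (N - 1)"
        by (simp add: t_pow power_mult_distrib)
      also have "real t * (4 ^ N * z) = 4 ^ N * B * L" using t0 by (simp add: z_def)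
      also have "real t * (4 ^ N * B * L) ^ (N - 1) = (4 ^ N * B) ^ (N - 1) * (real t * L ^ (N - 1))"
        by (simp add: power_mult_distrib)
      also have "\<dots> \<le> C * (real t * L ^ (N - 1))"
        using B L1 by (intro mult_right_mono) (auto simp: C_def)
      finally have X: "real t ^ N * (4 ^ N * z) ^ (N - 1) \<le> C * (real t * L ^ (N - 1))" .
      define v where "v = z / (2 * 4 ^ N)"
      have "1 \<le> 2 * (4::real) ^ N" using one_le_power[of "4::real" N] by linarith
      then have v: "0 \<le> v" "v \<le> 1" using z frac_le[of 1 z 1 "2 * 4 ^ N"] by (auto simp: v_def)
      \<comment> \<open>Since \<open>t > B * L\<close> and \<open>B \<ge> 2 * N\<close>, at least
        \<open>t / 2\<close> points remain besides those of the index set.\<close>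
      have "B * 1 \<le> B * L" using B L1 by (intro mult_left_mono) auto
      then have "2 * real N \<le> real t" using False B by linarith
      then have half: "real t / 2 \<le> real (t - N)" using t by (simp add: of_nat_diff)
      have "real N * L = v * (real t / 2)"
        using t0 by (simp add: v_def z_def B_def)
      also have "\<dots> \<le> v * real (t - N)" using half v by (intro mult_left_mono)
      finally have NL: "real N * L \<le> real (t - N) * v" by (simp add: mult.commute)
      have "(1 - v) ^ (t - N) \<le> exp (- v) ^ (t - N)"
        using v exp_ge_add_one_self[of "- v"] by (intro power_mono) auto
      also have "\<dots> = exp (- (real (t - N) * v))" by (simp add: exp_of_nat_mult[symmetric])
      also have "\<dots> \<le> exp (- (real N * L))" using NL by simp
      also have "\<dots> = 1 / real m ^ N"
        using t by (simp add: exp_minus exp_of_nat_mult L_def inverse_eq_divide)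
      finally have q: "(1 - v) ^ (t - N) \<le> 1 / real m ^ N" .
      \<comment> \<open>As \<open>t < m\<close>, the number of index sets is at most
        \<open>m ^ N\<close> and cancels against the failure probability; this is the additive
        2.\<close>
      have "(real t + 1) ^ N * (2 * (1 - v) ^ (t - N)) \<le> real m ^ N * (2 * (1 / real m ^ N))"
        using q v t by (intro mult_mono power_mono) auto
      also have "\<dots> = 2" using t by simp
      finally have "(real t + 1) ^ N * (2 * (1 - v) ^ (t - N)) \<le> 2" .
      moreover have "\<mu> \<le> real t ^ N * (4 ^ N * z) ^ (N - 1) + (real t + 1) ^ N * (2 * (1 - v) ^ (t - N))"
        using ef(3)[OF s(1,2)] unfolding s(3) v_def .
      ultimately show ?thesis using X unfolding mult.assoc by linarith
    qed
    then show ?thesis by (simp add: \<mu>_def L_def)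
  qed
  ultimately show ?thesis using that by (simp add: N_def)
qed

text \<open>The set where \<open>g\<close> differs from \<open>f\<close> lies in a null set, all of
  whose subsets are measurable in the completion; \<open>g\<close> itself may fail to be measurable
  for \<open>M\<close>.\<close>

lemma borel_measurable_completion_AE:
  assumes f: "f \<in> borel_measurable M" and eq: "AE x in M. g x = f x"
  shows "g \<in> borel_measurable (completion M)"
proof (rule measurableI)
  fix A :: "'b set" assume A: "A \<in> sets borel"
  have 1: "Measurable.pred (completion M) (\<lambda>x. f x \<in> A)"
    using A measurable_completion[OF f] by measurable
  have 2: "Measurable.pred (completion M) (\<lambda>x. g x \<noteq> f x)"
    "Measurable.pred (completion M) (\<lambda>x. g x \<noteq> f x \<and> g x \<in> A)"
    by (rule sets_completion_AE, use eq in eventually_elim, simp)+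
  have "Measurable.pred (completion M) (\<lambda>x. f x \<in> A \<and> \<not> g x \<noteq> f x \<or> g x \<noteq> f x \<and> g x \<in> A)"
    using 1 2 by measurable
  moreover have "(\<lambda>x. f x \<in> A \<and> \<not> g x \<noteq> f x \<or> g x \<noteq> f x \<and> g x \<in> A) = (\<lambda>x. g x \<in> A)" by auto
  ultimately have "Measurable.pred (completion M) (\<lambda>x. g x \<in> A)" by simp
  moreover have "g -` A \<inter> space (completion M) = {x \<in> space (completion M). g x \<in> A}" by auto
  ultimately show "g -` A \<inter> space (completion M) \<in> sets (completion M)" by (simp add: pred_def)
qed simp

text \<open>The combinatorial description of the cost holds in general position, so up to a null
  event. Integrability and the value of the integral therefore pass to the geometric cost under the
  completed measure.\<close>

lemma bb_complexity_sphere_sample: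
  assumes n: "CARD('n :: finite) \<ge> 2" and m: "CARD('n) \<le> m"
  defines "g \<equiv> \<lambda>a :: nat \<Rightarrow> real ^ 'n. real (algorithm_cost (facet_index a) CARD('n) m)"
  assumes g: "integrable (sphere_product m) g"
  shows "integrable (sphere_sample m) (\<lambda>a :: nat \<Rightarrow> real ^ 'n. real (bb_complexity m a))"
    and "(\<integral>a. real (bb_complexity m a) \<partial>(sphere_sample m :: (nat \<Rightarrow> real ^ 'n) measure)) = (\<integral>a. g a \<partial>sphere_product m)"
proof -
  let ?M = "sphere_product m :: (nat \<Rightarrow> real ^ 'n) measure"
  have meas: "g \<in> borel_measurable ?M" unfolding g_def by (rule borel_measurable_algorithm_cost)
  have AE: "AE a in ?M. real (bb_complexity m a) = g a"
    using AE_general_position[OF n, of m]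
    by eventually_elim (simp add: g_def bb_complexity_eq m)
  have meas': "(\<lambda>a. real (bb_complexity m a)) \<in> borel_measurable (completion ?M)"
    by (rule borel_measurable_completion_AE[OF meas AE])
  have "integrable (completion ?M) g" using g meas by (simp add: integrable_completion)
  then show "integrable (sphere_sample m) (\<lambda>a :: nat \<Rightarrow> real ^ 'n. real (bb_complexity m a))"
    unfolding sphere_sample_def
    using meas' AE_completion[OF AE] measurable_completion[OF meas]
    by (subst integrable_cong_AE[of _ _ g]) auto
  have "(\<integral>a. real (bb_complexity m a) \<partial>completion ?M) = (\<integral>a. g a \<partial>completion ?M)"
    using meas' measurable_completion[OF meas] AE_completion[OF AE] by (rule integral_cong_AE)
  also have "\<dots> = (\<integral>a. g a \<partial>?M)" by (rule integral_completion[OF meas])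
  finally show "(\<integral>a. real (bb_complexity m a) \<partial>(sphere_sample m :: (nat \<Rightarrow> real ^ 'n) measure)) = (\<integral>a. g a \<partial>?M)"
    by (simp add: sphere_sample_def)
qed

text \<open>Integrability is part of the claim because a non-integrable function has integral 0, for
  which the bound would say nothing. The exponent obtained is \<open>n - 1\<close>.\<close>

theorem theorem7:
  assumes "CARD('n :: finite) \<ge> 2"
  shows "\<exists>(C :: real) (k :: nat). \<forall>\<^sub>F m in sequentially.
    integrable (sphere_sample m :: (nat \<Rightarrow> real ^ 'n) measure) (\<lambda>a. real (bb_complexity m a)) \<and>
    (\<integral>a. real (bb_complexity m a) \<partial>(sphere_sample m :: (nat \<Rightarrow> real ^ 'n) measure))
      \<le> C * (real m)\<^sup>2 * ln (real m) ^ k"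
proof -
  obtain C :: real where C: "C \<ge> 0"
    "\<And>t m. CARD('n) \<le> t \<Longrightarrow> t < m \<Longrightarrow> ln (real m) \<ge> 1 \<Longrightarrow>
      (\<integral>a. real (card {I. facet_index (a :: nat \<Rightarrow> real ^ 'n) t I}) \<partial>sphere_product m)
        \<le> C * real t * ln (real m) ^ (CARD('n) - 1) + 2"
    using expected_facets_log_bound[OF assms] by blast
  \<comment> \<open>\<open>n + 2\<close> is the cost per listed facet; \<open>C + 2\<close> absorbs
    the additive 2, because \<open>m * L\<close> is at least 1.\<close>
  define D where "D = real (CARD('n) + 2) * (C + 2)"
  have bound: "integrable (sphere_sample m :: (nat \<Rightarrow> real ^ 'n) measure) (\<lambda>a. real (bb_complexity m a)) \<and>
      (\<integral>a. real (bb_complexity m a) \<partial>(sphere_sample m :: (nat \<Rightarrow> real ^ 'n) measure))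
        \<le> D * (real m)\<^sup>2 * ln (real m) ^ (CARD('n) - 1)"
    if m: "CARD('n) \<le> m" "ln (real m) \<ge> 1" for m
  proof -
    let ?M = "sphere_product m :: (nat \<Rightarrow> real ^ 'n) measure"
    define L where "L = ln (real m) ^ (CARD('n) - 1)"
    have L: "L \<ge> 1" using m by (simp add: L_def one_le_power)
    define f where "f a = real (algorithm_cost (facet_index a) CARD('n) m)" for a :: "nat \<Rightarrow> real ^ 'n"
    define F where "F k a = real (card {I. facet_index a (CARD('n) + k) I})" for k and a :: "nat \<Rightarrow> real ^ 'n"
    have intF: "integrable ?M (F k)" if "k < m - CARD('n)" for k
      unfolding F_def using that by (intro expected_facets_le(1)) auto
    have "real (algorithm_cost (facet_index a) CARD('n) m)
        \<le> real ((CARD('n) + 2) * (\<Sum>k<m - CARD('n). card {I. facet_index a (CARD('n) + k) I}))"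
      for a :: "nat \<Rightarrow> real ^ 'n" by (rule of_nat_mono[OF algorithm_cost_le])
    then have fF: "f a \<le> real (CARD('n) + 2) * (\<Sum>k<m - CARD('n). F k a)" for a
      unfolding f_def F_def of_nat_mult of_nat_sum .
    have intS: "integrable ?M (\<lambda>a. real (CARD('n) + 2) * (\<Sum>k<m - CARD('n). F k a))"
      using intF by (intro integrable_mult_right Bochner_Integration.integrable_sum) auto
    have meas: "f \<in> borel_measurable ?M" unfolding f_def by (rule borel_measurable_algorithm_cost)
    have intf: "integrable ?M f"
    proof (rule Bochner_Integration.integrable_bound[OF intS meas], intro AE_I2)
      fix a
      have "0 \<le> f a" by (simp add: f_def)
      then show "norm (f a) \<le> norm (real (CARD('n) + 2) * (\<Sum>k<m - CARD('n). F k a))"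
        using fF[of a] by simp
    qed
    have "(\<integral>a. f a \<partial>?M) \<le> (\<integral>a. real (CARD('n) + 2) * (\<Sum>k<m - CARD('n). F k a) \<partial>?M)"
      by (intro integral_mono intf intS fF)
    also have "\<dots> = real (CARD('n) + 2) * (\<Sum>k<m - CARD('n). \<integral>a. F k a \<partial>?M)"
      using intF by (simp add: Bochner_Integration.integral_sum)
    also have "\<dots> \<le> real (CARD('n) + 2) * (\<Sum>k<m - CARD('n). (C + 2) * real m * L)"
    proof (intro mult_left_mono sum_mono)
      fix k assume k: "k \<in> {..<m - CARD('n)}"
      have "(\<integral>a. F k a \<partial>?M) \<le> C * real (CARD('n) + k) * L + 2"
        unfolding F_def L_def using k by (intro C(2) m(2)) auto
      also have "\<dots> \<le> C * real m * L + 2 * (real m * L)"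
      proof (intro add_mono mult_right_mono mult_left_mono)
        have "1 * 1 \<le> real m * L" using m assms L by (intro mult_mono) auto
        then show "2 \<le> 2 * (real m * L)" by simp
      qed (use k C L in auto)
      finally show "(\<integral>a. F k a \<partial>?M) \<le> (C + 2) * real m * L" by (simp add: algebra_simps)
    qed simp
    also have "\<dots> = D * (real (m - CARD('n)) * (real m * L))" by (simp add: D_def)
    also have "\<dots> \<le> D * (real m * (real m * L))"
      using C(1) L by (intro mult_left_mono mult_right_mono) (auto simp: D_def)
    finally have "(\<integral>a. f a \<partial>?M) \<le> D * (real m)\<^sup>2 * L" by (simp add: power2_eq_square)
    then show ?thesis
      using bb_complexity_sphere_sample[OF assms m(1)] intf unfolding f_def L_def by simp
  qed
  have "\<forall>\<^sub>F m in sequentially. CARD('n) \<le> m \<and> ln (real m) \<ge> 1"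
  proof (intro eventually_conj eventually_ge_at_top)
    have "filterlim (\<lambda>m. ln (real m)) at_top sequentially"
      by (rule filterlim_compose[OF ln_at_top filterlim_real_sequentially])
    then show "\<forall>\<^sub>F m in sequentially. ln (real m) \<ge> 1" by (simp add: filterlim_at_top)
  qed
  then have "\<forall>\<^sub>F m in sequentially.
    integrable (sphere_sample m :: (nat \<Rightarrow> real ^ 'n) measure) (\<lambda>a. real (bb_complexity m a)) \<and>
    (\<integral>a. real (bb_complexity m a) \<partial>(sphere_sample m :: (nat \<Rightarrow> real ^ 'n) measure))
      \<le> D * (real m)\<^sup>2 * ln (real m) ^ (CARD('n) - 1)"
    by (rule eventually_mono) (use bound in blast)
  then show ?thesis by blast
qed

end
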